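(* The symplectic loaves in $M(n,\mathbb C)$ are the same for all choices of $\wp$; that is, for all $\wp,\wp'\in P^{2n}$, the collection of symplectic loaves in $M(n,\mathbb C)$ defined by $\{\cdot,\cdot\}_\wp$ coincides with the collection of symplectic loaves defined by $\{\cdot,\cdot\}_{\wp'}$.
   Context: $P$ is the free abelian group with basis $\lambda_\beta,\lambda_{\mu_1},\dots,\lambda_{\mu_{n-1}},\lambda_{\nu_1},\dots,\lambda_{\nu_{n-1}}$; also write these $2n-1$ elements as $\lambda_1,\dots,\lambda_{2n-1}$. For $1\le i,j\le n$ the symbols $\alpha_{i,j}$ pair additively with $P$ by $(\lambda_\beta|\alpha_{i,j})=1$, $(\lambda_{\mu_k}|\alpha_{i,j})=1$ if $k<i$ and $0$ otherwise, $(\lambda_{\nu_k}|\alpha_{i,j})=1$ if $k<j$ and $0$ otherwise; $(\alpha|\lambda)=(\lambda|\alpha)$. Let $a_{ij}$ be the coordinate functions on $M(n,\mathbb C)$. The standard (holomorphic) Poisson bracket is determined by antisymmetry and $\{a_{ij},a_{ik}\}_0=a_{ij}a_{ik}$ if $j<k$; $\{a_{ij},a_{kj}\}_0=a_{ij}a_{kj}$ if $i<k$; $\{a_{ij},a_{st}\}_0=0$ if $i<s$, $t<j$; $\{a_{ij},a_{st}\}_0=2a_{it}a_{sj}$ if $i<s$, $j<t$. For $\wp=(\zeta_1,\dots,\zeta_n,\xi_1,\dots,\xi_n)\in P^{2n}$, $$\{a_{ij},a_{st}\}_\wp=\{a_{ij},a_{st}\}_0+\big((\alpha_{s,t}|\zeta_i+\xi_j)-(\alpha_{i,j}|\zeta_s+\xi_t)\big)a_{ij}a_{st}.$$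 A symplectic leaf of $\{\cdot,\cdot\}_\wp$ is a maximal (connected) integral manifold of the involutive distribution assigning to $a\in M(n,\mathbb C)$ the complex span of the values at $a$ of the Hamiltonian vector fields. The group $\mathcal S_{\rm mult}\cong(\mathbb C^* )^{2n-1}$ is generated by the maps $\check\lambda_k(c)$, $c\in\mathbb C^*$, $1\le k\le 2n-1$, acting on $M(n,\mathbb C)$ by $a_{st}\mapsto c^{(\alpha_{s,t}|\lambda_k)}a_{st}$. A symplectic loaf is a set $\mathcal S_{\rm mult}(\mathcal L)$ with $\mathcal L$ a symplectic leaf. *)

theory Defs
  imports
    "HOL-Analysis.Analysis"
    "HOL-Algebra.Free_Abelian_Groups"
    "HOL-Algebra.Generated_Groups"
    "HOL-Algebra.Bij"
begin

text \<open>
  The index set \<open>{1, \<dots>, n}\<close>, with \<open>n \<ge> 1\<close>, is an arbitrary finite linearly ordered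
  type \<open>'n\<close>.
\<close>

type_synonym 'n cmatrix = "((complex, 'n) vec, 'n) vec"

section \<open>The lattice P and its pairing with the roots\<close>

datatype 'n gen = Beta | Mu 'n | Nu 'n

type_synonym 'n weight = "'n gen \<Rightarrow>\<^sub>0 int"
type_synonym 'n param = "('n \<Rightarrow> 'n weight) \<times> ('n \<Rightarrow> 'n weight)"

text \<open>
  The indices \<open>1, \<dots>, n - 1\<close> are the non-maximal elements of \<open>'n\<close>, so \<open>gens\<close> has \<open>2n - 1\<close>
  elements.
\<close>

definition gens :: "'n::{finite,linorder} gen set" where
  "gens = {Beta} \<union> Mu ` {k. \<exists>i. k < i} \<union> Nu ` {k. \<exists>i. k < i}"

definition lattice_P :: "'n::{finite,linorder} weight set" where
  "lattice_P = carrier (free_Abelian_group gens)"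

text \<open>\<open>gen_pairing b i j\<close> is \<open>(\<lambda>\<^sub>b | \<alpha>\<^sub>i\<^sub>j)\<close>, and \<open>pairing l i j\<close> is \<open>(l | \<alpha>\<^sub>i\<^sub>j)\<close>.\<close>

fun gen_pairing :: "'n::{finite,linorder} gen \<Rightarrow> 'n \<Rightarrow> 'n \<Rightarrow> int" where
  "gen_pairing Beta i j = 1"
| "gen_pairing (Mu k) i j = (if k < i then 1 else 0)"
| "gen_pairing (Nu k) i j = (if k < j then 1 else 0)"

definition pairing :: "'n::{finite,linorder} weight \<Rightarrow> 'n \<Rightarrow> 'n \<Rightarrow> int" where
  "pairing l i j = (\<Sum>b\<in>Poly_Mapping.keys l. Poly_Mapping.lookup l b * gen_pairing b i j)"

lemma pairing_frag_of [simp]: "pairing (frag_of b) i j = gen_pairing b i j"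
  by (simp add: pairing_def)

lemma pairing_add:
  fixes l m :: "'n::{finite,linorder} weight"
  shows "pairing (l + m) i j = pairing l i j + pairing m i j"
proof -
  have ext: "pairing x i j = (\<Sum>b\<in>UNIV. Poly_Mapping.lookup x b * gen_pairing b i j)"
    if "finite (UNIV :: 'n gen set)" for x :: "'n weight"
    unfolding pairing_def
    by (rule sum.mono_neutral_left) (auto simp: that in_keys_iff)
  have "b \<in> {Beta} \<union> range Mu \<union> range Nu" for b :: "'n gen"
    by (cases b) auto
  then have "finite (UNIV :: 'n gen set)"
    by (intro finite_subset [of UNIV "{Beta} \<union> range Mu \<union> range Nu"]) (blast, simp)
  then show ?thesis
    by (simp add: ext lookup_add distrib_right sum.distrib)
qed

text \<open>\<open>P\<^sup>2\<^sup>n\<close>, whose elements are written as pairs \<open>(\<zeta>, \<xi>)\<close> of \<open>n\<close>-tuples.\<close>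

definition params :: "'n::{finite,linorder} param set" where
  "params = (UNIV \<rightarrow> lattice_P) \<times> (UNIV \<rightarrow> lattice_P)"


section \<open>The Poisson brackets\<close>

text \<open>
  \<open>std_bracket i j s t a\<close> and \<open>coord_bracket w i j s t a\<close> are the values at \<open>a\<close> of
  \<open>{a\<^sub>i\<^sub>j, a\<^sub>s\<^sub>t}\<close> for the standard bracket and for the bracket with parameter \<open>w\<close>.
\<close>

definition std_half :: "'n::{finite,linorder} \<Rightarrow> 'n \<Rightarrow> 'n \<Rightarrow> 'n \<Rightarrow> 'n cmatrix \<Rightarrow> complex" where
  "std_half i j s t a =
     (if i = s \<and> j < t then a $ i $ j * a $ s $ t
      else if i < s \<and> j = t then a $ i $ j * a $ s $ t
      else if i < s \<and> j < t then 2 * a $ i $ t * a $ s $ j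
      else 0)"

definition std_bracket :: "'n::{finite,linorder} \<Rightarrow> 'n \<Rightarrow> 'n \<Rightarrow> 'n \<Rightarrow> 'n cmatrix \<Rightarrow> complex" where
  "std_bracket i j s t a = std_half i j s t a - std_half s t i j a"

lemma std_bracket_relations:
  "std_bracket i j s t a = - std_bracket s t i j a"
  "j < k \<Longrightarrow> std_bracket i j i k a = a $ i $ j * a $ i $ k"
  "i < k \<Longrightarrow> std_bracket i j k j a = a $ i $ j * a $ k $ j"
  "i < s \<Longrightarrow> t < j \<Longrightarrow> std_bracket i j s t a = 0"
  "i < s \<Longrightarrow> j < t \<Longrightarrow> std_bracket i j s t a = 2 * a $ i $ t * a $ s $ j"
  by (auto simp: std_bracket_def std_half_def)

definition coord_bracket ::
  "'n::{finite,linorder} param \<Rightarrow>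
     'n \<Rightarrow> 'n \<Rightarrow> 'n \<Rightarrow> 'n \<Rightarrow> 'n cmatrix \<Rightarrow> complex" where
  "coord_bracket w i j s t a =
     (case w of (\<zeta>, \<xi>) \<Rightarrow>
       std_bracket i j s t a
       + of_int (pairing (\<zeta> i + \<xi> j) s t - pairing (\<zeta> s + \<xi> t) i j) * a $ i $ j * a $ s $ t)"

definition cscale :: "complex \<Rightarrow> 'n::finite cmatrix \<Rightarrow> 'n cmatrix" where
  "cscale c a = map_matrix ((*) c) a"

global_interpretation cmat: vector_space "cscale :: complex \<Rightarrow> 'n::finite cmatrix \<Rightarrow> 'n cmatrix"
  by unfold_locales (simp_all add: cscale_def map_matrix_def vec_eq_iff algebra_simps)

definition holomorphic_fun :: "('n::finite cmatrix \<Rightarrow> complex) \<Rightarrow> bool" where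
  "holomorphic_fun f \<longleftrightarrow>
     (\<forall>a. \<exists>f'. (f has_derivative f') (at a) \<and> Vector_Spaces.linear cscale (*) f')"

definition partial :: "'n::finite \<Rightarrow> 'n \<Rightarrow> ('n cmatrix \<Rightarrow> complex) \<Rightarrow> 'n cmatrix \<Rightarrow> complex" where
  "partial i j f a = deriv (\<lambda>z. f (a + cscale z (axis i (axis j 1)))) 0"

text \<open>The biderivation on holomorphic functions determined by its values on coordinates.\<close>

definition poisson ::
  "'n::{finite,linorder} param \<Rightarrow>
     ('n cmatrix \<Rightarrow> complex) \<Rightarrow> ('n cmatrix \<Rightarrow> complex) \<Rightarrow> 'n cmatrix \<Rightarrow> complex" where
  "poisson w f g a =
     (\<Sum>i\<in>UNIV. \<Sum>j\<in>UNIV. \<Sum>s\<in>UNIV. \<Sum>t\<in>UNIV.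
        coord_bracket w i j s t a * partial i j f a * partial s t g a)"

lemma partial_coordinate:
  "partial i j (\<lambda>a. a $ s $ t) a = (if i = s \<and> j = t then 1 else 0)"
proof -
  have "((\<lambda>z. a $ s $ t + z * axis i (axis j (1::complex)) $ s $ t)
          has_field_derivative (axis i (axis j 1) $ s $ t)) (at 0)"
    by (auto intro!: derivative_eq_intros)
  then have "partial i j (\<lambda>a. a $ s $ t) a = axis i (axis j (1::complex)) $ s $ t"
    by (simp add: partial_def cscale_def DERIV_imp_deriv)
  then show ?thesis
    by (auto simp: axis_def)
qed

lemma poisson_coordinates:
  "poisson w (\<lambda>a. a $ i $ j) (\<lambda>a. a $ s $ t) a = coord_bracket w i j s t a"
proof -
  have delta: "(\<Sum>p\<in>UNIV. \<Sum>q\<in>UNIV. F p q * (if p = k \<and> q = l then 1 else 0)) = F k l"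
    for F :: "'n::{finite,linorder} \<Rightarrow> 'n \<Rightarrow> complex" and k l
  proof -
    have "(\<Sum>q\<in>UNIV. F p q * (if p = k \<and> q = l then 1 else 0)) = (if p = k then F p l else 0)" for p
      by (cases "p = k") (simp_all add: if_distrib [where f = "\<lambda>x. _ * x"] cong: if_cong)
    then show ?thesis
      by simp
  qed
  show ?thesis
    unfolding poisson_def partial_coordinate delta ..
qed

definition hamiltonian_field :: "'n::{finite,linorder} param \<Rightarrow> ('n cmatrix \<Rightarrow> complex) \<Rightarrow> 'n cmatrix \<Rightarrow> 'n cmatrix" where
  "hamiltonian_field w f a = (\<chi> s t. poisson w f (\<lambda>x. x $ s $ t) a)"

definition hamiltonian_distribution :: "'n::{finite,linorder} param \<Rightarrow> 'n cmatrix \<Rightarrow> 'n cmatrix set" where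
  "hamiltonian_distribution w a = cmat.span {hamiltonian_field w f a |f. holomorphic_fun f}"


section \<open>Symplectic leaves and loaves\<close>

text \<open>
  An integral manifold of \<open>D\<close> is an injectively immersed (not necessarily embedded) complex
  submanifold with tangent spaces \<open>D a\<close>. It is given as a subset of \<open>M(n, \<complex>)\<close> with a
  manifold topology \<open>T\<close> of its own, usually finer than the subspace topology. A chart is given
  by its inverse \<open>\<phi>\<close>, defined on an open subset \<open>U\<close> of a complex subspace \<open>V\<close> of
  \<open>M(n, \<complex>)\<close>: as \<open>dim (D a) \<le> n\<^sup>2\<close>, these \<open>V\<close> provide all the model spaces \<open>\<complex>\<^sup>d\<close> needed.
  Transition maps are automatically holomorphic, since each \<open>\<phi>\<close> is an immersion into
  \<open>M(n, \<complex>)\<close> and a homeomorphism onto its image in \<open>T\<close>.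
\<close>

definition integral_manifold ::
  "('n::finite cmatrix \<Rightarrow> 'n cmatrix set) \<Rightarrow> 'n cmatrix topology \<Rightarrow> bool" where
  "integral_manifold D T \<longleftrightarrow>
     Hausdorff_space T \<and> second_countable T \<and>
     (\<forall>a\<in>topspace T. \<exists>(V :: 'n cmatrix set) U \<phi>.
        cmat.subspace V \<and> openin (top_of_set V) U \<and>
        a \<in> \<phi> ` U \<and> openin T (\<phi> ` U) \<and>
        homeomorphic_map (top_of_set U) (subtopology T (\<phi> ` U)) \<phi> \<and>
        (\<forall>u\<in>U. \<exists>\<phi>'. (\<phi> has_derivative \<phi>') (at u within V) \<and>
           Vector_Spaces.linear cscale cscale \<phi>' \<and>
           inj_on \<phi>' V \<and> \<phi>' ` V = D (\<phi> u)))"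

definition connected_integral_manifold ::
  "('n::finite cmatrix \<Rightarrow> 'n cmatrix set) \<Rightarrow> 'n cmatrix set \<Rightarrow> bool" where
  "connected_integral_manifold D L \<longleftrightarrow>
     L \<noteq> {} \<and> (\<exists>T. topspace T = L \<and> connected_space T \<and> integral_manifold D T)"

definition symplectic_leaf :: "'n::{finite,linorder} param \<Rightarrow> 'n cmatrix set \<Rightarrow> bool" where
  "symplectic_leaf w L \<longleftrightarrow>
     connected_integral_manifold (hamiltonian_distribution w) L \<and>
     (\<forall>L'. connected_integral_manifold (hamiltonian_distribution w) L' \<longrightarrow> L \<subseteq> L' \<longrightarrow> L' = L)"

text \<open>
  \<open>check_lam b c\<close> is the action of the one-parameter subgroup attached to the basis element
  \<open>\<lambda>\<^sub>b\<close> of \<open>P\<close>. \<open>S_mult\<close> is the group of transformations of \<open>M(n, \<complex>)\<close> generated by these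
  bijections.
\<close>

definition check_lam :: "'n::{finite,linorder} gen \<Rightarrow> complex \<Rightarrow> 'n cmatrix \<Rightarrow> 'n cmatrix" where
  "check_lam b c a = (\<chi> s t. c powi pairing (frag_of b) s t * a $ s $ t)"

lemma check_lam_in_BijGroup:
  assumes "c \<noteq> 0"
  shows "check_lam b c \<in> carrier (BijGroup UNIV)"
proof -
  have "check_lam b c (check_lam b (inverse c) a) = a" "check_lam b (inverse c) (check_lam b c a) = a" for a
    using assms by (simp_all add: check_lam_def vec_eq_iff power_int_inverse)
  then have "bij (check_lam b c)"
    by (intro bij_betw_byWitness [where f' = "check_lam b (inverse c)"]) auto
  then show ?thesis
    by (simp add: BijGroup_def Bij_def)
qed

definition S_mult :: "('n::{finite,linorder} cmatrix \<Rightarrow> 'n cmatrix) set" where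
  "S_mult = generate (BijGroup UNIV) {check_lam b c |b c. b \<in> gens \<and> c \<noteq> 0}"

definition symplectic_loaves :: "'n::{finite,linorder} param \<Rightarrow> 'n cmatrix set set" where
  "symplectic_loaves w = {\<Union>g\<in>S_mult. g ` L |L. symplectic_leaf w L}"

end

theory Submission
  imports Defs "HOL-Complex_Analysis.Cauchy_Integral_Formula"
begin

text \<open>
  The idea is to describe the leaves as orbits of explicit flows. In sign form the standard bracket is
  \<open>{a\<^sub>i\<^sub>j, a\<^sub>s\<^sub>t} = (sgn (s - i) + sgn (t - j)) a\<^sub>i\<^sub>t a\<^sub>s\<^sub>j\<close>, and a parameter \<open>w\<close> adds the term
  \<open>twist w i j s t * a\<^sub>i\<^sub>j a\<^sub>s\<^sub>t\<close>. The Hamiltonian field of a coordinate function \<open>a\<^sub>i\<^sub>j\<close> can be integrated in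
  closed form and for all complex times. Let the orbit of a matrix be the set of points that can be reached
  from it by these flows.

  The loaves can be compared at once if the leaves are the orbits. Indeed the twist is additive in the row
  \<open>s\<close> and in the column \<open>t\<close>, so that the flow of \<open>a\<^sub>i\<^sub>j\<close> for \<open>w'\<close> is the flow for \<open>w\<close> followed by a scaling of rows and
  columns (\<open>flow_change_param\<close>). These scalings form the group \<open>S_mult\<close> (\<open>torus_in_S_mult\<close>, \<open>S_mult_torus\<close>), and they
  conjugate flows to flows (\<open>torus_flow\<close>). So the orbits of a matrix for \<open>w\<close> and for \<open>w'\<close> have the same
  saturation by \<open>S_mult\<close> (\<open>torus_orbit_invariant\<close>).

  That the leaves are the orbits (\<open>symplectic_leaf_iff_orbit\<close>) is the orbit theorem of Stefan and Sussmann in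
  the present case. It rests on the fact that the flows preserve the distribution (\<open>dflow_distribution\<close>). By the
  Jacobi identity, the Poisson tensor along a flow and its push-forward by the flow obey the
  same linear differential equation, so the flows are Poisson maps (\<open>flow_poisson\<close>). Composing flows at
  variable times and applying the inverse function theorem then gives coordinates near a point \<open>p\<close> in
  which every tangent curve along which the rank is that at \<open>p\<close> has constant transversal component
  (\<open>plaque_box_exists\<close>). Hence orbits are integral manifolds for the topology defined by short
  tangent curves (\<open>orbit_connected_integral_manifold\<close>), and they are open in that topology, so that a connected integral
  manifold lies in a single orbit (\<open>connected_integral_manifold_subset_orbit\<close>).
\<close>

section \<open>The brackets in sign form and the Jacobi identity\<close>

text \<open>
  The sign of \<open>b - a\<close>, so that the four cases of the standard bracket become one formula.
\<close>

definition ord_sgn :: "'n::linorder \<Rightarrow> 'n \<Rightarrow> complex" where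
  "ord_sgn a b = (if a < b then 1 else if b < a then -1 else 0)"

lemma ord_sgn_self [simp]: "ord_sgn a a = 0"
  by (simp add: ord_sgn_def)

lemma ord_sgn_antisym: "ord_sgn b a = - ord_sgn a b"
  by (auto simp: ord_sgn_def)

lemma ord_sgn_less: "u < v \<Longrightarrow> ord_sgn u v = 1" "u < v \<Longrightarrow> ord_sgn v u = -1"
  by (auto simp: ord_sgn_def)

text \<open>
  For distinct \<open>a, b, c\<close> the signs going round the triangle cannot all agree, so two of them are
  equal and the third is opposite; if exactly two of the points coincide, one sign is \<open>0\<close> and the
  other two are opposite.
\<close>

lemma ord_sgn_cyclic:
  "ord_sgn a b * ord_sgn b c + ord_sgn b c * ord_sgn c a + ord_sgn c a * ord_sgn a b = (if a = b \<and> b = c then 0 else -1)"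
proof -
  have two: "ord_sgn u v * ord_sgn v u = -1" if "u \<noteq> v" for u v :: 'a
    using that by (cases u v rule: linorder_cases) (simp_all add: ord_sgn_less)
  consider "a = b" "b = c" | "a = b" "b \<noteq> c" | "b = c" "a \<noteq> b" | "a = c" "a \<noteq> b"
    | "a < b" "b < c" | "b < c" "c < a" | "c < a" "a < b"
    | "c < b" "b < a" | "a < c" "c < b" | "b < a" "a < c"
    by (metis linorder_less_linear)
  then show ?thesis
    by cases (auto simp: ord_sgn_less two dest: less_trans)
qed

lemma std_bracket_ord_sgn:
  "std_bracket i j s t a = (ord_sgn i s + ord_sgn j t) * a $ i $ t * a $ s $ j"
  by (cases i s rule: linorder_cases; cases j t rule: linorder_cases)
     (auto simp: std_bracket_def std_half_def ord_sgn_def)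

text \<open>
  The coefficient of \<open>a\<^sub>i\<^sub>j a\<^sub>s\<^sub>t\<close> by which the bracket with parameter \<open>w\<close> differs from the standard one.
\<close>

definition twist :: "'n::{finite,linorder} param \<Rightarrow> 'n \<Rightarrow> 'n \<Rightarrow> 'n \<Rightarrow> 'n \<Rightarrow> complex" where
  "twist w i j s t = of_int (pairing (fst w i + snd w j) s t - pairing (fst w s + snd w t) i j)"

lemma twist_antisym: "twist w s t i j = - twist w i j s t"
  by (simp add: twist_def)

lemma twist_self [simp]: "twist w i j i j = 0"
  by (simp add: twist_def)

lemma gen_pairing_split:
  "gen_pairing b s t = gen_pairing b s t' + gen_pairing b s' t - gen_pairing b s' t'"
  by (cases b) auto

lemma pairing_split:
  "pairing l s t = pairing l s t' + pairing l s' t - pairing l s' t'"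
  unfolding pairing_def sum.distrib [symmetric] sum_subtractf [symmetric]
  by (rule sum.cong [OF refl], subst gen_pairing_split [of _ s t t' s'])
     (simp add: algebra_simps)

text \<open>
  As a function of \<open>s\<close> and \<open>t\<close> the pairing with a fixed weight has the form \<open>f s + g t\<close>, because this is
  true of the pairing with each generator. Two matrix positions may therefore exchange their columns.
\<close>

lemma pairing_exchange: "pairing l s t + pairing l k m = pairing l s m + pairing l k t"
  using pairing_split [of l s t m k] by simp

lemma twist_exchange: "twist w i j s t + twist w i j k m = twist w i j s m + twist w i j k t"
proof -
  have "pairing (fst w i + snd w j) s t + pairing (fst w i + snd w j) k m
      = pairing (fst w i + snd w j) s m + pairing (fst w i + snd w j) k t"
    by (rule pairing_exchange)
  then show ?thesis
    unfolding twist_def of_int_add [symmetric] of_int_eq_iff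
    by (simp add: pairing_add)
qed

text \<open>
  The exchange rule at the position \<open>(i, j)\<close>, where the twist with itself vanishes. It is what
  makes the twisted flows as explicit as the untwisted ones, and what makes a change of parameter an
  action of the torus.
\<close>

lemma twist_cross: "twist w i j i t + twist w i j s j = twist w i j s t"
  using twist_exchange [of w i j i t s j] by simp

definition bracket :: "'n::{finite,linorder} param \<Rightarrow> 'n \<Rightarrow> 'n \<Rightarrow> 'n \<Rightarrow> 'n \<Rightarrow> 'n cmatrix \<Rightarrow> complex" where
  "bracket w i j s t x = (ord_sgn i s + ord_sgn j t) * x $ i $ t * x $ s $ j + twist w i j s t * x $ i $ j * x $ s $ t"

lemma coord_bracket_eq: "coord_bracket w i j s t = bracket w i j s t"
  by (rule ext) (simp add: coord_bracket_def bracket_def std_bracket_ord_sgn twist_def split: prod.split)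

lemma bracket_antisym: "bracket w s t i j x = - bracket w i j s t x"
  by (simp add: bracket_def twist_antisym [of w s t i j] ord_sgn_antisym [of s i] ord_sgn_antisym [of t j] algebra_simps)

text \<open>
  The differential at \<open>x\<close>, in the direction \<open>v\<close>, of the quadratic function \<open>bracket w i j s t\<close>.
\<close>

definition dbracket where
  "dbracket w i j s t x v =
    (ord_sgn i s + ord_sgn j t) * (v $ i $ t * x $ s $ j + x $ i $ t * v $ s $ j)
    + twist w i j s t * (v $ i $ j * x $ s $ t + x $ i $ j * v $ s $ t)"

text \<open>
  The Hamiltonian vector field of the coordinate function \<open>a\<^sub>i\<^sub>j\<close>.
\<close>

definition ham :: "'n::{finite,linorder} param \<Rightarrow> 'n \<Rightarrow> 'n \<Rightarrow> 'n cmatrix \<Rightarrow> 'n cmatrix" where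
  "ham w i j x = (\<chi> s t. bracket w i j s t x)"

lemma ham_nth [simp]: "ham w i j x $ s $ t = bracket w i j s t x"
  by (simp add: ham_def)

text \<open>
  Only two cubic monomials, \<open>m\<close> and \<open>m'\<close>, occur in the cyclic sum. Their coefficients are opposite,
  and each is the difference of the cyclic sign sums of the rows and of the columns. These are both
  \<open>-1\<close> unless all rows, or all columns, coincide; in that case \<open>m = m'\<close>.
\<close>

lemma jacobi_std:
  fixes x :: "'n::{finite,linorder} cmatrix"
  defines "P \<equiv> \<lambda>i j k l s t. (ord_sgn k s + ord_sgn l t) *
    ((ord_sgn i k + ord_sgn j t) * x $ i $ t * x $ k $ j * x $ s $ l
     + (ord_sgn i s + ord_sgn j l) * x $ i $ l * x $ s $ j * x $ k $ t)"
  shows "P i j k l s t + P k l s t i j + P s t i j k l = 0"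
proof -
  define a b c where "a = ord_sgn i k" "b = ord_sgn k s" "c = ord_sgn s i"
  define d e f where "d = ord_sgn j l" "e = ord_sgn l t" "f = ord_sgn t j"
  have sgs: "ord_sgn i k = a" "ord_sgn k s = b" "ord_sgn s i = c" "ord_sgn j l = d" "ord_sgn l t = e" "ord_sgn t j = f"
      "ord_sgn k i = -a" "ord_sgn s k = -b" "ord_sgn i s = -c" "ord_sgn l j = -d" "ord_sgn t l = -e" "ord_sgn j t = -f"
    by (simp_all add: a_b_c_def d_e_f_def ord_sgn_antisym [of k i] ord_sgn_antisym [of s k] ord_sgn_antisym [of i s]
         ord_sgn_antisym [of l j] ord_sgn_antisym [of t l] ord_sgn_antisym [of j t])
  define m m' where "m = x $ i $ t * x $ k $ j * x $ s $ l" and "m' = x $ i $ l * x $ s $ j * x $ k $ t"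
  have "P i j k l s t + P k l s t i j + P s t i j k l
      = ((a * b + b * c + c * a) - (d * e + e * f + f * d)) * (m - m')"
    unfolding P_def sgs m_def m'_def by (simp add: algebra_simps)
  also have "\<dots> = 0"
  proof (cases "(i = k \<and> k = s) \<or> (j = l \<and> l = t)")
    case True
    then have "m = m'" by (auto simp: m_def m'_def)
    then show ?thesis by simp
  next
    case False
    then show ?thesis
      unfolding a_b_c_def d_e_f_def ord_sgn_cyclic by auto
  qed
  finally show ?thesis .
qed

text \<open>
  The Jacobi identity for three coordinate functions: since \<open>dbracket\<close> is the differential of \<open>bracket\<close>, a summand
  is the bracket of a coordinate function with a bracket of coordinate functions. The twist only adds
  terms that cancel in the cyclic sum, by antisymmetry and the exchange rule.
\<close>

lemma jacobi:
  "dbracket w k l s t x (ham w i j x) + dbracket w s t i j x (ham w k l x) + dbracket w i j k l x (ham w s t x) = 0"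
proof -
  note J = jacobi_std [where i = i and j = j and k = k and l = l and s = s and t = t and x = x]
  define A B C where "A = twist w i j k l" and "B = twist w k l s t" and "C = twist w s t i j"
  have o1: "twist w i j k l = A" "twist w k l s t = B" "twist w s t i j = C"
     "twist w k l i j = -A" "twist w s t k l = -B" "twist w i j s t = -C"
    by (simp_all add: A_def B_def C_def twist_antisym [of w k l i j] twist_antisym [of w s t k l] twist_antisym [of w i j s t])
  have o2: "twist w i j k t = A - C - twist w i j s l" "twist w k l s j = B - A - twist w k l i t" "twist w s t i l = C - B - twist w s t k j"
    using twist_exchange [of w i j k l s t] twist_exchange [of w k l s t i j] twist_exchange [of w s t i j k l] o1
    by (simp_all add: algebra_simps)
  define a b c where "a = ord_sgn i k" "b = ord_sgn k s" "c = ord_sgn s i"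
  define d e f where "d = ord_sgn j l" "e = ord_sgn l t" "f = ord_sgn t j"
  have sgs: "ord_sgn i k = a" "ord_sgn k s = b" "ord_sgn s i = c" "ord_sgn j l = d" "ord_sgn l t = e" "ord_sgn t j = f"
      "ord_sgn k i = -a" "ord_sgn s k = -b" "ord_sgn i s = -c" "ord_sgn l j = -d" "ord_sgn t l = -e" "ord_sgn j t = -f"
    by (simp_all add: a_b_c_def d_e_f_def ord_sgn_antisym [of k i] ord_sgn_antisym [of s k] ord_sgn_antisym [of i s]
         ord_sgn_antisym [of l j] ord_sgn_antisym [of t l] ord_sgn_antisym [of j t])
  let ?q = "\<lambda>i j k l s t. (ord_sgn k s + ord_sgn l t) *
    ((ord_sgn i k + ord_sgn j t) * x $ i $ t * x $ k $ j * x $ s $ l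
     + (ord_sgn i s + ord_sgn j l) * x $ i $ l * x $ s $ j * x $ k $ t)"
  have "dbracket w k l s t x (ham w i j x) + dbracket w s t i j x (ham w k l x) + dbracket w i j k l x (ham w s t x)
      = ?q i j k l s t + ?q k l s t i j + ?q s t i j k l"
    unfolding dbracket_def ham_nth bracket_def o1 o2 sgs
    by algebra
  then show ?thesis
    using J by (rule trans)
qed

section \<open>The Hamiltonian flows of the coordinate functions\<close>

text \<open>
  The entire function \<open>(exp u - 1) / u\<close>. Integrating the Hamiltonian field of \<open>a\<^sub>i\<^sub>j\<close> produces it at a
  multiple of the constant value of \<open>a\<^sub>i\<^sub>j\<close>; with the removable singularity filled in, the same formula
  covers the matrices with \<open>a\<^sub>i\<^sub>j = 0\<close>.
\<close>

definition exp_quot :: "complex \<Rightarrow> complex" where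
  "exp_quot u = (if u = 0 then 1 else (exp u - 1) / u)"

lemma exp_quot_mult: "u * exp_quot u = exp u - 1"
  by (simp add: exp_quot_def)

lemma exp_quot_holomorphic: "exp_quot holomorphic_on UNIV"
proof -
  have "deriv exp (0::complex) = 1"
    using DERIV_imp_deriv [OF DERIV_exp, of "0::complex"] by simp
  then have "exp_quot = (\<lambda>u. if u = 0 then deriv exp 0 else (exp u - exp 0) / (u - 0))"
    by (auto simp: exp_quot_def fun_eq_iff)
  then show ?thesis
    using pole_lemma_open [of exp UNIV 0] by (simp add: holomorphic_on_exp)
qed

lemma exp_quot_deriv: "(exp_quot has_field_derivative deriv exp_quot u) (at u within A)"
  using holomorphic_derivI [OF exp_quot_holomorphic open_UNIV UNIV_I, of u] has_field_derivative_at_within by blast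

lemma exp_quot_deriv_deriv: "(deriv exp_quot has_field_derivative deriv (deriv exp_quot) u) (at u within A)"
  using holomorphic_derivI [OF holomorphic_deriv [OF exp_quot_holomorphic open_UNIV] open_UNIV UNIV_I, of u]
    has_field_derivative_at_within by blast

lemma exp_quot_ode1: "exp_quot u + u * deriv exp_quot u = exp u"
proof -
  have "((\<lambda>u. u * exp_quot u) has_field_derivative exp_quot u + u * deriv exp_quot u) (at u)"
    by (auto intro!: derivative_eq_intros exp_quot_deriv)
  moreover have "((\<lambda>u. u * exp_quot u) has_field_derivative exp u) (at u)"
    unfolding exp_quot_mult by (auto intro!: derivative_eq_intros)
  ultimately show ?thesis
    by (rule DERIV_unique)
qed

lemma exp_quot_ode2: "2 * deriv exp_quot u + u * deriv (deriv exp_quot) u = exp u"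
proof -
  have "((\<lambda>u. exp_quot u + u * deriv exp_quot u) has_field_derivative 2 * deriv exp_quot u + u * deriv (deriv exp_quot) u) (at u)"
    by (auto intro!: derivative_eq_intros exp_quot_deriv exp_quot_deriv_deriv)
  moreover have "((\<lambda>u. exp_quot u + u * deriv exp_quot u) has_field_derivative exp u) (at u)"
    unfolding exp_quot_ode1 by (auto intro!: derivative_eq_intros)
  ultimately show ?thesis
    by (rule DERIV_unique)
qed

lemma exp_quot_minus: "exp u * exp_quot (- u) = exp_quot u"
  by (auto simp: exp_quot_def field_simps exp_minus)

text \<open>
  The integral of \<open>q * exp (x * c * q)\<close> for \<open>x\<close> from \<open>0\<close> to \<open>z\<close>. Its partial derivative with respect to \<open>c\<close> is \<open>dflow_int\<close>.
\<close>

definition flow_int :: "complex \<Rightarrow> complex \<Rightarrow> complex \<Rightarrow> complex" where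
  "flow_int q z c = z * q * exp_quot (z * c * q)"

definition dflow_int :: "complex \<Rightarrow> complex \<Rightarrow> complex \<Rightarrow> complex" where
  "dflow_int q z c = (z * q)\<^sup>2 * deriv exp_quot (z * c * q)"

lemma flow_int_exp: "1 + c * flow_int q z c = exp (z * c * q)"
  using exp_quot_mult [of "z * c * q"] by (simp add: flow_int_def algebra_simps)

text \<open>
  This is the identity \<open>flow_int_exp\<close> differentiated with respect to \<open>c\<close>.
\<close>

lemma flow_int_dflow_int: "flow_int q z c + c * dflow_int q z c = z * q * exp (z * c * q)"
  unfolding exp_quot_ode1 [symmetric] by (simp add: flow_int_def dflow_int_def power2_eq_square algebra_simps)

lemma flow_int_0 [simp]: "flow_int q 0 c = 0"
  by (simp add: flow_int_def)

lemma dflow_int_0 [simp]: "dflow_int q 0 c = 0"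
  by (simp add: dflow_int_def)

lemma flow_int_minus: "exp (z * c * q) * flow_int q (- z) c = - flow_int q z c"
  using exp_quot_minus [of "z * c * q"] by (simp add: flow_int_def algebra_simps)

lemma flow_int_has_derivative [derivative_intros]:
  assumes z: "(\<zeta> has_derivative \<zeta>') (at u within S)" and c: "(\<kappa> has_derivative \<kappa>') (at u within S)"
  shows "((\<lambda>u. flow_int q (\<zeta> u) (\<kappa> u)) has_derivative
    (\<lambda>e. q * exp (\<zeta> u * \<kappa> u * q) * \<zeta>' e + dflow_int q (\<zeta> u) (\<kappa> u) * \<kappa>' e)) (at u within S)"
proof -
  let ?v = "\<zeta> u * \<kappa> u * q"
  have v: "((\<lambda>u. \<zeta> u * \<kappa> u * q) has_derivative (\<lambda>e. (\<zeta> u * \<kappa>' e + \<zeta>' e * \<kappa> u) * q)) (at u within S)"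
    by (auto intro!: derivative_eq_intros z c)
  have "((\<lambda>u. exp_quot (\<zeta> u * \<kappa> u * q)) has_derivative
      (\<lambda>e. deriv exp_quot ?v * ((\<zeta> u * \<kappa>' e + \<zeta>' e * \<kappa> u) * q))) (at u within S)"
    using has_derivative_compose [OF v exp_quot_deriv [where A = UNIV, unfolded has_field_derivative_def]]
    by (simp add: o_def)
  then have "((\<lambda>u. flow_int q (\<zeta> u) (\<kappa> u)) has_derivative
    (\<lambda>e. \<zeta> u * q * (deriv exp_quot ?v * ((\<zeta> u * \<kappa>' e + \<zeta>' e * \<kappa> u) * q)) + \<zeta>' e * q * exp_quot ?v)) (at u within S)"
    unfolding flow_int_def by (auto intro!: derivative_eq_intros z)
  then show ?thesis
    unfolding exp_quot_ode1 [symmetric] dflow_int_def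
    by (rule back_subst [of "\<lambda>d. (_ has_derivative d) _"])
       (simp add: fun_eq_iff algebra_simps power2_eq_square)
qed

lemma flow_int_DERIV: "((\<lambda>z. flow_int q z c) has_field_derivative q * exp (z * c * q)) (at z)"
  unfolding has_field_derivative_def
  by (rule flow_int_has_derivative [THEN has_derivative_eq_rhs]) (auto intro!: derivative_eq_intros)

text \<open>
  This is a mixed second derivative of \<open>flow_int\<close>; it enters the variational equation \<open>dflow_DERIV\<close>.
\<close>

lemma dflow_int_DERIV: "((\<lambda>z. dflow_int q z c) has_field_derivative z * q\<^sup>2 * exp (z * c * q)) (at z)"
proof -
  let ?v = "z * c * q"
  have v: "((\<lambda>z. z * c * q) has_field_derivative c * q) (at z)"
    by (auto intro!: derivative_eq_intros)
  have "((\<lambda>z. (z * q)\<^sup>2 * deriv exp_quot (z * c * q)) has_field_derivative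
      (2 * z * q\<^sup>2 * deriv exp_quot ?v + (z * q)\<^sup>2 * (deriv (deriv exp_quot) ?v * (c * q)))) (at z)"
    using DERIV_chain2 [OF exp_quot_deriv_deriv v]
    by (auto intro!: derivative_eq_intros simp: power2_eq_square)
  then show ?thesis
    unfolding exp_quot_ode2 [symmetric] dflow_int_def
    by (rule back_subst [of "\<lambda>d. (_ has_field_derivative d) _"])
       (simp add: algebra_simps power2_eq_square)
qed

lemma continuous_on_gq [continuous_intros]:
  assumes "continuous_on S f" "continuous_on S h"
  shows "continuous_on S (\<lambda>u. flow_int q (f u) (h u))"
proof -
  have "continuous_on S (\<lambda>u. exp_quot (f u * h u * q))"
    by (rule continuous_on_compose2 [OF holomorphic_on_imp_continuous_on [OF exp_quot_holomorphic]])
       (auto intro!: continuous_intros assms)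
  then show ?thesis
    unfolding flow_int_def by (intro continuous_intros assms)
qed

lemma continuous_on_hq [continuous_intros]:
  assumes "continuous_on S f" "continuous_on S h"
  shows "continuous_on S (\<lambda>u. dflow_int q (f u) (h u))"
proof -
  have "continuous_on S (\<lambda>u. deriv exp_quot (f u * h u * q))"
    by (rule continuous_on_compose2 [OF holomorphic_on_imp_continuous_on
          [OF holomorphic_deriv [OF exp_quot_holomorphic open_UNIV]]])
       (auto intro!: continuous_intros assms)
  then show ?thesis
    unfolding dflow_int_def by (intro continuous_intros assms)
qed

text \<open>
  The flow of the Hamiltonian field of \<open>a\<^sub>i\<^sub>j\<close> at complex time \<open>z\<close>. Along this flow \<open>a\<^sub>i\<^sub>j\<close> is constant, hence
  the entries of row \<open>i\<close> and column \<open>j\<close> vary exponentially, and every other entry obeys a scalar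
  linear equation whose inhomogeneous term is a product of two of these exponentials. So the
  flow is complete, and it is entire in \<open>z\<close> and in the matrix.
\<close>

definition flow :: "'n::{finite,linorder} param \<Rightarrow> 'n \<Rightarrow> 'n \<Rightarrow> complex \<Rightarrow> 'n cmatrix \<Rightarrow> 'n cmatrix" where
  "flow w i j z x = (\<chi> s t. exp (z * x $ i $ j * twist w i j s t) *
     (x $ s $ t + x $ i $ t * x $ s $ j * flow_int (ord_sgn i s + ord_sgn j t) z (x $ i $ j)))"

text \<open>
  The differential of \<open>flow w i j z\<close> at \<open>x\<close>, in the direction \<open>v\<close>.
\<close>

definition dflow :: "'n::{finite,linorder} param \<Rightarrow> 'n \<Rightarrow> 'n \<Rightarrow> complex \<Rightarrow> 'n cmatrix \<Rightarrow> 'n cmatrix \<Rightarrow> 'n cmatrix" where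
  "dflow w i j z x v = (\<chi> s t. exp (z * x $ i $ j * twist w i j s t) *
     (z * twist w i j s t * v $ i $ j *
        (x $ s $ t + x $ i $ t * x $ s $ j * flow_int (ord_sgn i s + ord_sgn j t) z (x $ i $ j))
      + v $ s $ t
      + (v $ i $ t * x $ s $ j + x $ i $ t * v $ s $ j) * flow_int (ord_sgn i s + ord_sgn j t) z (x $ i $ j)
      + x $ i $ t * x $ s $ j * dflow_int (ord_sgn i s + ord_sgn j t) z (x $ i $ j) * v $ i $ j))"

lemma flow_nth: "flow w i j z x $ s $ t = exp (z * x $ i $ j * twist w i j s t) *
     (x $ s $ t + x $ i $ t * x $ s $ j * flow_int (ord_sgn i s + ord_sgn j t) z (x $ i $ j))"
  by (simp add: flow_def)

lemma flow_pivot [simp]: "flow w i j z x $ i $ j = x $ i $ j"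
  by (simp add: flow_nth flow_int_def)

lemma flow_row: "flow w i j z x $ i $ t = exp (z * x $ i $ j * (twist w i j i t + ord_sgn j t)) * x $ i $ t"
proof -
  have "flow w i j z x $ i $ t = exp (z * x $ i $ j * twist w i j i t) *
      (x $ i $ t * (1 + x $ i $ j * flow_int (ord_sgn j t) z (x $ i $ j)))"
    by (simp add: flow_nth algebra_simps)
  then show ?thesis
    unfolding flow_int_exp by (simp add: exp_add algebra_simps)
qed

lemma flow_col: "flow w i j z x $ s $ j = exp (z * x $ i $ j * (twist w i j s j + ord_sgn i s)) * x $ s $ j"
proof -
  have "flow w i j z x $ s $ j = exp (z * x $ i $ j * twist w i j s j) *
      (x $ s $ j * (1 + x $ i $ j * flow_int (ord_sgn i s) z (x $ i $ j)))"
    by (simp add: flow_nth algebra_simps)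
  then show ?thesis
    unfolding flow_int_exp by (simp add: exp_add algebra_simps)
qed

text \<open>
  The product of two exponentials that drives the entry \<open>(s, t)\<close>.
\<close>

lemma flow_row_col:
  "flow w i j z x $ i $ t * flow w i j z x $ s $ j =
   exp (z * x $ i $ j * twist w i j s t) * exp (z * x $ i $ j * (ord_sgn i s + ord_sgn j t)) * (x $ i $ t * x $ s $ j)"
  unfolding flow_row flow_col twist_cross [of w i j t s, symmetric]
  by (simp add: exp_add algebra_simps)

lemma flow_0 [simp]: "flow w i j 0 x = x"
  by (simp add: flow_def)

text \<open>
  One half of the group law: the flow is invertible, with the flow at the opposite time as inverse.
\<close>

lemma flow_minus: "flow w i j (- z) (flow w i j z x) = x"
proof -
  have "flow w i j (- z) (flow w i j z x) $ s $ t = x $ s $ t" for s t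
  proof -
    let ?c = "x $ i $ j" and ?o = "twist w i j s t" and ?q = "ord_sgn i s + ord_sgn j t"
    let ?r = "x $ i $ t * x $ s $ j"
    have "flow w i j (- z) (flow w i j z x) $ s $ t
       = exp (- (z * ?c * ?o)) * (exp (z * ?c * ?o) * (x $ s $ t + ?r * flow_int ?q z ?c)
         + exp (z * ?c * ?o) * exp (z * ?c * ?q) * ?r * flow_int ?q (- z) ?c)"
      using flow_row_col [of w i j z x t s] by (simp add: flow_nth [of w i j z x s t] flow_nth [of w i j "-z"])
    also have "\<dots> = (exp (- (z * ?c * ?o)) * exp (z * ?c * ?o)) *
        (x $ s $ t + ?r * (flow_int ?q z ?c + exp (z * ?c * ?q) * flow_int ?q (- z) ?c))"
      by (simp add: algebra_simps)
    also have "\<dots> = x $ s $ t"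
      unfolding flow_int_minus by (simp add: exp_minus)
    finally show ?thesis .
  qed
  then show ?thesis by (simp add: vec_eq_iff)
qed

lemma dflow_pivot [simp]: "dflow w i j z x v $ i $ j = v $ i $ j"
  by (simp add: dflow_def flow_int_def dflow_int_def)

lemma dflow_row: "dflow w i j z x v $ i $ t = exp (z * x $ i $ j * (twist w i j i t + ord_sgn j t)) *
   (v $ i $ t + z * (twist w i j i t + ord_sgn j t) * v $ i $ j * x $ i $ t)"
proof -
  let ?c = "x $ i $ j" and ?o = "twist w i j i t" and ?q = "ord_sgn j t"
  have "dflow w i j z x v $ i $ t = exp (z * ?c * ?o) *
     ((z * ?o * v $ i $ j * x $ i $ t + v $ i $ t) * (1 + ?c * flow_int ?q z ?c)
      + x $ i $ t * v $ i $ j * (flow_int ?q z ?c + ?c * dflow_int ?q z ?c))"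
    by (simp add: dflow_def algebra_simps)
  then show ?thesis
    unfolding flow_int_exp flow_int_dflow_int by (simp add: exp_add algebra_simps)
qed

lemma dflow_col: "dflow w i j z x v $ s $ j = exp (z * x $ i $ j * (twist w i j s j + ord_sgn i s)) *
   (v $ s $ j + z * (twist w i j s j + ord_sgn i s) * v $ i $ j * x $ s $ j)"
proof -
  let ?c = "x $ i $ j" and ?o = "twist w i j s j" and ?q = "ord_sgn i s"
  have "dflow w i j z x v $ s $ j = exp (z * ?c * ?o) *
     ((z * ?o * v $ i $ j * x $ s $ j + v $ s $ j) * (1 + ?c * flow_int ?q z ?c)
      + x $ s $ j * v $ i $ j * (flow_int ?q z ?c + ?c * dflow_int ?q z ?c))"
    by (simp add: dflow_def algebra_simps)
  then show ?thesis
    unfolding flow_int_exp flow_int_dflow_int by (simp add: exp_add algebra_simps)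
qed

lemma flow_DERIV:
  "((\<lambda>z. flow w i j z x $ s $ t) has_field_derivative bracket w i j s t (flow w i j z x)) (at z)"
proof -
  let ?c = "x $ i $ j" and ?o = "twist w i j s t" and ?q = "ord_sgn i s + ord_sgn j t"
  let ?r = "x $ i $ t * x $ s $ j"
  have e: "((\<lambda>z. exp (z * ?c * ?o)) has_field_derivative ?c * ?o * exp (z * ?c * ?o)) (at z)"
    by (auto intro!: derivative_eq_intros)
  have "((\<lambda>z. flow w i j z x $ s $ t) has_field_derivative
     ?c * ?o * flow w i j z x $ s $ t + exp (z * ?c * ?o) * (?r * (?q * exp (z * ?c * ?q)))) (at z)"
    unfolding flow_nth
    by (rule derivative_eq_intros e flow_int_DERIV refl | simp add: algebra_simps)+
  then show ?thesis
    unfolding bracket_def mult.assoc [of "ord_sgn i s + ord_sgn j t"] flow_row_col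
    by (rule back_subst [of "\<lambda>d. (_ has_field_derivative d) _"]) (simp add: algebra_simps)
qed

text \<open>
  The variational equation: the Jacobian of the flow is transported by the linearised field.
\<close>

lemma dflow_DERIV:
  "((\<lambda>z. dflow w i j z x v $ s $ t) has_field_derivative
     dbracket w i j s t (flow w i j z x) (dflow w i j z x v)) (at z)"
proof -
  let ?c = "x $ i $ j" and ?o = "twist w i j s t" and ?q = "ord_sgn i s + ord_sgn j t"
  let ?r = "x $ i $ t * x $ s $ j"
  let ?m = "exp (z * ?c * ?o)" and ?M = "exp (z * ?c * ?q)"
  have e: "((\<lambda>z. exp (z * ?c * ?o)) has_field_derivative ?c * ?o * exp (z * ?c * ?o)) (at z)"
    by (auto intro!: derivative_eq_intros)
  have 1: "((\<lambda>z. dflow w i j z x v $ s $ t) has_field_derivative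
     ?c * ?o * dflow w i j z x v $ s $ t + ?m *
      (?o * v $ i $ j * (x $ s $ t + ?r * flow_int ?q z ?c) + z * ?o * v $ i $ j * (?r * (?q * ?M))
       + (v $ i $ t * x $ s $ j + x $ i $ t * v $ s $ j) * (?q * ?M)
       + ?r * (z * ?q\<^sup>2 * ?M) * v $ i $ j)) (at z)"
    unfolding dflow_def vec_lambda_beta
    by (rule derivative_eq_intros e flow_int_DERIV dflow_int_DERIV refl | simp add: algebra_simps)+
  have 2: "dflow w i j z x v $ i $ t * flow w i j z x $ s $ j + flow w i j z x $ i $ t * dflow w i j z x v $ s $ j
     = ?m * ?M * (v $ i $ t * x $ s $ j + x $ i $ t * v $ s $ j + z * (?o + ?q) * v $ i $ j * ?r)"
    unfolding dflow_row dflow_col flow_row flow_col twist_cross [of w i j t s, symmetric]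
    by (simp add: exp_add algebra_simps)
  from 1 show ?thesis
    unfolding dbracket_def 2
    by (rule back_subst [of "\<lambda>d. (_ has_field_derivative d) _"])
       (simp add: flow_nth [of w i j z x s t] algebra_simps power2_eq_square)
qed

lemma has_derivative_vecI:
  fixes f :: "'a::real_normed_vector \<Rightarrow> 'b::euclidean_space ^ 'n"
  assumes "\<And>i. ((\<lambda>u. f u $ i) has_derivative (\<lambda>e. f' e $ i)) (at u within S)"
  shows "(f has_derivative f') (at u within S)"
proof -
  have "((\<lambda>u. f u \<bullet> b) has_derivative (\<lambda>e. f' e \<bullet> b)) (at u within S)" if "b \<in> Basis" for b
  proof -
    obtain i d where "b = axis i d" using \<open>b \<in> Basis\<close> by (auto simp: Basis_vec_def)
    then show ?thesis
      using has_derivative_inner_left [OF assms [of i], of d] by (simp add: inner_axis)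
  qed
  then show ?thesis
    by (simp add: has_derivative_componentwise_within [of f])
qed

text \<open>
  The total derivative of the flow, in time and in the matrix together, stated for composites because
  the charts of the leaves are built by composing flows at variable times.
\<close>

lemma flow_has_derivative:
  assumes z: "(\<zeta> has_derivative \<zeta>') (at u within S)" and x: "(\<xi> has_derivative \<xi>') (at u within S)"
  shows "((\<lambda>u. flow w i j (\<zeta> u) (\<xi> u)) has_derivative
    (\<lambda>e. cscale (\<zeta>' e) (ham w i j (flow w i j (\<zeta> u) (\<xi> u))) + dflow w i j (\<zeta> u) (\<xi> u) (\<xi>' e)))
    (at u within S)"
proof (rule has_derivative_vecI, rule has_derivative_vecI)
  fix s t
  have x': "((\<lambda>u. \<xi> u $ s $ t) has_derivative (\<lambda>e. \<xi>' e $ s $ t)) (at u within S)" for s t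
    by (intro bounded_linear.has_derivative [OF bounded_linear_vec_nth] x)
  let ?c = "\<xi> u $ i $ j" and ?o = "twist w i j s t" and ?q = "ord_sgn i s + ord_sgn j t"
  let ?r = "\<xi> u $ i $ t * \<xi> u $ s $ j"
  let ?m = "exp (\<zeta> u * ?c * ?o)" and ?M = "exp (\<zeta> u * ?c * ?q)"
  have "((\<lambda>u. \<zeta> u * \<xi> u $ i $ j * ?o) has_derivative
     (\<lambda>e. (\<zeta> u * \<xi>' e $ i $ j + \<zeta>' e * ?c) * ?o)) (at u within S)"
    by (intro has_derivative_mult_left has_derivative_mult z x')
  from has_derivative_compose [OF this DERIV_exp [unfolded has_field_derivative_def]]
  have e: "((\<lambda>u. exp (\<zeta> u * \<xi> u $ i $ j * ?o)) has_derivative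
     (\<lambda>e. ?m * ((\<zeta> u * \<xi>' e $ i $ j + \<zeta>' e * ?c) * ?o))) (at u within S)"
    by simp
  have f: "((\<lambda>u. flow w i j (\<zeta> u) (\<xi> u) $ s $ t) has_derivative
    (\<lambda>e. ?m * (\<xi>' e $ s $ t + (?r * (?q * ?M * \<zeta>' e + dflow_int ?q (\<zeta> u) ?c * \<xi>' e $ i $ j)
        + (\<xi> u $ i $ t * \<xi>' e $ s $ j + \<xi>' e $ i $ t * \<xi> u $ s $ j) * flow_int ?q (\<zeta> u) ?c))
       + ?m * ((\<zeta> u * \<xi>' e $ i $ j + \<zeta>' e * ?c) * ?o) * (\<xi> u $ s $ t + ?r * flow_int ?q (\<zeta> u) ?c))) (at u within S)"
    unfolding flow_nth
    by (intro has_derivative_mult e has_derivative_add flow_int_has_derivative z x')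
  have p: "bracket w i j s t (flow w i j (\<zeta> u) (\<xi> u)) = ?q * (?m * ?M * ?r) + ?o * ?c * (?m * (\<xi> u $ s $ t + ?r * flow_int ?q (\<zeta> u) ?c))"
    unfolding bracket_def mult.assoc [of "ord_sgn i s + ord_sgn j t"] flow_row_col by (simp add: flow_nth)
  show "((\<lambda>u. flow w i j (\<zeta> u) (\<xi> u) $ s $ t) has_derivative
    (\<lambda>e. (cscale (\<zeta>' e) (ham w i j (flow w i j (\<zeta> u) (\<xi> u))) + dflow w i j (\<zeta> u) (\<xi> u) (\<xi>' e)) $ s $ t))
    (at u within S)"
    by (rule has_derivative_eq_rhs [OF f])
       (simp add: fun_eq_iff cscale_def map_matrix_def p dflow_def algebra_simps)
qed

section \<open>Uniqueness for linear differential equations\<close>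

text \<open>
  Gronwall's argument: \<open>exp (- 2 K t) |W t|\<^sup>2\<close> does not increase.
\<close>

lemma linear_ode_vanishes:
  fixes W :: "real \<Rightarrow> 'a::real_inner"
  assumes W: "\<And>t. (W has_vector_derivative W' t) (at t)"
    and bound: "\<And>t. 0 \<le> t \<Longrightarrow> t \<le> 1 \<Longrightarrow> norm (W' t) \<le> K * norm (W t)"
    and W0: "W 0 = 0"
  shows "W 1 = 0"
proof -
  define N where "N t = exp (- (2 * K) * t) * (W t \<bullet> W t)" for t
  have "N 1 \<le> N 0"
  proof (rule DERIV_nonpos_imp_nonincreasing [where f = N])
    fix t :: real assume t: "0 \<le> t" "t \<le> 1"
    have "((\<lambda>t. W t \<bullet> W t) has_derivative (\<lambda>h. W t \<bullet> (h *\<^sub>R W' t) + (h *\<^sub>R W' t) \<bullet> W t)) (at t)"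
      by (intro has_derivative_inner W [unfolded has_vector_derivative_def])
    then have "((\<lambda>t. W t \<bullet> W t) has_real_derivative 2 * (W t \<bullet> W' t)) (at t)"
      unfolding has_field_derivative_def
      by (rule has_derivative_eq_rhs) (simp add: fun_eq_iff inner_commute)
    then have "(N has_real_derivative
        - (2 * K) * exp (- (2 * K) * t) * (W t \<bullet> W t) + 2 * (W t \<bullet> W' t) * exp (- (2 * K) * t)) (at t)"
      unfolding N_def by (auto intro!: derivative_eq_intros simp: algebra_simps)
    moreover have "W t \<bullet> W' t \<le> K * (W t \<bullet> W t)"
    proof -
      have "W t \<bullet> W' t \<le> norm (W t) * norm (W' t)"
        by (rule norm_cauchy_schwarz)
      also have "\<dots> \<le> norm (W t) * (K * norm (W t))"
        by (intro mult_left_mono bound t norm_ge_zero)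
      finally show ?thesis
        by (simp add: power2_norm_eq_inner [symmetric] power2_eq_square algebra_simps)
    qed
    then have "2 * exp (- (2 * K) * t) * (W t \<bullet> W' t - K * (W t \<bullet> W t)) \<le> 0"
      by (intro mult_nonneg_nonpos) auto
    then have "- (2 * K) * exp (- (2 * K) * t) * (W t \<bullet> W t) + 2 * (W t \<bullet> W' t) * exp (- (2 * K) * t) \<le> 0"
      by (simp add: algebra_simps)
    ultimately show "\<exists>y. (N has_real_derivative y) (at t) \<and> y \<le> 0"
      by blast
  qed simp
  then have "W 1 \<bullet> W 1 \<le> 0"
    by (simp add: N_def W0 mult_le_0_iff)
  then show ?thesis
    using inner_ge_zero [of "W 1"] by (metis antisym inner_eq_zero_iff)
qed

text \<open>
  A finite family of functions of a complex variable, restricted to the segment from \<open>0\<close> to \<open>z\<close>.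
\<close>

lemma linear_ode_family_vanishes:
  fixes W :: "'i::finite \<Rightarrow> complex \<Rightarrow> complex"
  assumes W: "\<And>p z. (W p has_field_derivative W' p z) (at z)"
    and bound: "\<And>p r. \<exists>K. \<forall>z. norm z \<le> r \<longrightarrow> norm (W' p z) \<le> K * (\<Sum>q\<in>UNIV. norm (W q z))"
    and W0: "\<And>p. W p 0 = 0"
  shows "W p z = 0"
proof -
  define V where "V t = (\<chi> p. W p (of_real t * z))" for t :: real
  define V' where "V' t = (\<chi> p. z * W' p (of_real t * z))" for t :: real
  have V: "(V has_vector_derivative V' t) (at t)" for t
    unfolding has_vector_derivative_def
  proof (rule has_derivative_vecI)
    fix p
    have 1: "((\<lambda>t. of_real t * z) has_derivative (\<lambda>h. of_real h * z)) (at t)"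
      by (auto intro!: derivative_eq_intros)
    show "((\<lambda>u. V u $ p) has_derivative (\<lambda>e. (e *\<^sub>R V' t) $ p)) (at t)"
      using has_derivative_compose [OF 1 W [of p, unfolded has_field_derivative_def]]
      unfolding vector_scaleR_component unfolding V_def V'_def vec_lambda_beta scaleR_conv_of_real
      by (rule has_derivative_eq_rhs) (simp add: fun_eq_iff mult_ac)
  qed
  obtain K where K: "\<And>p x. norm x \<le> norm z \<Longrightarrow> norm (W' p x) \<le> K p * (\<Sum>q\<in>UNIV. norm (W q x))"
    using bound [where r = "norm z"] by metis
  let ?L = "norm z * (\<Sum>p\<in>UNIV. \<bar>K p\<bar>) * of_nat CARD('i)"
  have "V 1 = 0"
  proof (rule linear_ode_vanishes [OF V, where K = ?L])
    fix t :: real assume t: "0 \<le> t" "t \<le> 1"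
    have tz: "norm (of_real t * z) \<le> norm z"
      using t by (simp add: norm_mult mult_left_le_one_le)
    let ?S = "\<Sum>q\<in>UNIV. norm (W q (of_real t * z))"
    have S: "?S \<le> of_nat CARD('i) * norm (V t)"
      by (rule sum_bounded_above [where K = "norm (V t)", simplified])
         (metis V_def Finite_Cartesian_Product.norm_nth_le vec_lambda_beta)
    have "norm (V' t) \<le> (\<Sum>p\<in>UNIV. norm (V' t $ p))"
      unfolding norm_vec_def by (rule L2_set_le_sum) simp
    also have "\<dots> \<le> (\<Sum>p\<in>UNIV. norm z * (\<bar>K p\<bar> * (of_nat CARD('i) * norm (V t))))"
    proof (rule sum_mono)
      fix p
      have "norm (W' p (of_real t * z)) \<le> K p * ?S"
        by (rule K [OF tz])
      also have "\<dots> \<le> \<bar>K p\<bar> * ?S"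
        by (intro mult_right_mono sum_nonneg) auto
      also have "\<dots> \<le> \<bar>K p\<bar> * (of_nat CARD('i) * norm (V t))"
        by (intro mult_left_mono S) simp
      finally show "norm (V' t $ p) \<le> norm z * (\<bar>K p\<bar> * (of_nat CARD('i) * norm (V t)))"
        by (simp add: V'_def norm_mult mult_left_mono)
    qed
    also have "\<dots> = ?L * norm (V t)"
      by (simp add: sum_distrib_left sum_distrib_right mult_ac)
    finally show "norm (V' t) \<le> ?L * norm (V t)" .
  qed (simp add: V_def W0 vec_eq_iff)
  then show ?thesis
    by (simp add: V_def vec_eq_iff)
qed

section \<open>The flows preserve the bracket\<close>

lemma dbracket_antisym: "dbracket w s t i j x v = - dbracket w i j s t x v"
  by (simp add: dbracket_def twist_antisym [of w s t i j] ord_sgn_antisym [of s i] ord_sgn_antisym [of t j] algebra_simps)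

lemma dbracket_minus: "dbracket w i j s t x (- v) = - dbracket w i j s t x v"
  by (simp add: dbracket_def algebra_simps)

lemma dbracket_diff: "dbracket w i j s t x (u - v) = dbracket w i j s t x u - dbracket w i j s t x v"
  by (simp add: dbracket_def algebra_simps)

lemma dbracket_bound:
  assumes "\<And>s t. norm (v $ s $ t) \<le> S"
  shows "norm (dbracket w i j k l y v) \<le> (norm (ord_sgn i k + ord_sgn j l) + norm (twist w i j k l)) * (2 * norm y * S)"
proof -
  have S: "0 \<le> S" using order_trans [OF norm_ge_zero assms] .
  have y: "norm (y $ s $ t) \<le> norm y" for s t
    by (rule order_trans [OF Finite_Cartesian_Product.norm_nth_le Finite_Cartesian_Product.norm_nth_le])
  have p: "norm (v $ a $ b * y $ c $ d + y $ a' $ b' * v $ c' $ d') \<le> 2 * norm y * S" for a b c d a' b' c' d'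
  proof -
    have "norm (v $ a $ b) * norm (y $ c $ d) \<le> S * norm y"
      by (intro mult_mono assms y) (use S in auto)
    moreover have "norm (y $ a' $ b') * norm (v $ c' $ d') \<le> norm y * S"
      by (intro mult_mono assms y) auto
    ultimately show ?thesis
      by (intro order_trans [OF norm_triangle_ineq]) (simp add: norm_mult algebra_simps)
  qed
  have "norm (dbracket w i j k l y v) \<le> norm (ord_sgn i k + ord_sgn j l) * (2 * norm y * S) + norm (twist w i j k l) * (2 * norm y * S)"
    unfolding dbracket_def
    by (rule order_trans [OF norm_triangle_ineq], unfold norm_mult)
       (intro add_mono mult_left_mono p norm_ge_zero)
  then show ?thesis
    by (simp add: distrib_right)
qed

text \<open>
  Along the flow, the brackets of the coordinate functions obey a linear differential equation. Before
  the Jacobi identity is used, the derivative is a double bracket with \<open>a\<^sub>i\<^sub>j\<close> in the outer place; the identity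
  turns it into the linearised field acting on either index of the bracket.
\<close>

lemma bracket_flow_DERIV:
  "((\<lambda>z. bracket w k l s t (flow w i j z x)) has_field_derivative
     dbracket w i j k l (flow w i j z x) (\<chi> p q. bracket w p q s t (flow w i j z x))
     + dbracket w i j s t (flow w i j z x) (\<chi> p q. bracket w k l p q (flow w i j z x))) (at z)"
proof -
  let ?y = "flow w i j z x"
  have 1: "((\<lambda>z. bracket w k l s t (flow w i j z x)) has_field_derivative dbracket w k l s t ?y (ham w i j ?y)) (at z)"
    unfolding bracket_def [of w k l s t] dbracket_def ham_nth
    by (rule derivative_eq_intros flow_DERIV refl | simp add: algebra_simps)+
  have h: "(\<chi> p q. bracket w k l p q ?y) = ham w k l ?y" "(\<chi> p q. bracket w p q s t ?y) = - ham w s t ?y"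
    by (simp_all add: vec_eq_iff bracket_antisym [of w _ _ s t])
  have "dbracket w k l s t ?y (ham w i j ?y) = - dbracket w i j k l ?y (ham w s t ?y) + dbracket w i j s t ?y (ham w k l ?y)"
    using jacobi [of w k l s t ?y i j] unfolding dbracket_antisym [of w s t i j] by algebra
  with 1 show ?thesis
    unfolding h dbracket_minus by simp
qed

definition munit :: "'n \<times> 'n \<Rightarrow> 'n::finite cmatrix" where
  "munit a = axis (fst a) (axis (snd a) 1)"

text \<open>
  The push-forward of the Poisson tensor at \<open>x\<close> by the differential of the flow.
\<close>

definition pushforward :: "'n::{finite,linorder} param \<Rightarrow> 'n \<Rightarrow> 'n \<Rightarrow> complex \<Rightarrow> 'n cmatrix \<Rightarrow> 'n \<Rightarrow> 'n \<Rightarrow> 'n \<Rightarrow> 'n \<Rightarrow> complex" where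
  "pushforward w i j z x k l s t = (\<Sum>a\<in>UNIV. \<Sum>b\<in>UNIV.
     dflow w i j z x (munit a) $ k $ l * dflow w i j z x (munit b) $ s $ t
       * bracket w (fst a) (snd a) (fst b) (snd b) x)"

text \<open>
  By the variational equation, the push-forward obeys the same linear equation as the bracket.
\<close>

lemma pushforward_DERIV:
  "((\<lambda>z. pushforward w i j z x k l s t) has_field_derivative
     dbracket w i j k l (flow w i j z x) (\<chi> p q. pushforward w i j z x p q s t)
     + dbracket w i j s t (flow w i j z x) (\<chi> p q. pushforward w i j z x k l p q)) (at z)"
proof -
  let ?y = "flow w i j z x" and ?J = "\<lambda>a. dflow w i j z x (munit a)"
  let ?p = "\<lambda>a b. bracket w (fst a) (snd a) (fst b) (snd b) x"
  have "((\<lambda>z. pushforward w i j z x k l s t) has_field_derivative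
     (\<Sum>a\<in>UNIV. \<Sum>b\<in>UNIV. (dbracket w i j k l ?y (?J a) * ?J b $ s $ t + dbracket w i j s t ?y (?J b) * ?J a $ k $ l) * ?p a b)) (at z)"
    unfolding pushforward_def
    by (intro DERIV_sum DERIV_cmult_right DERIV_mult dflow_DERIV)
  moreover have "(\<Sum>a\<in>UNIV. \<Sum>b\<in>UNIV. (dbracket w i j k l ?y (?J a) * ?J b $ s $ t + dbracket w i j s t ?y (?J b) * ?J a $ k $ l) * ?p a b)
    = dbracket w i j k l ?y (\<chi> p q. pushforward w i j z x p q s t) + dbracket w i j s t ?y (\<chi> p q. pushforward w i j z x k l p q)"
    unfolding dbracket_def pushforward_def vec_lambda_beta sum_distrib_left sum_distrib_right sum.distrib [symmetric]
    by (intro sum.cong refl) (simp add: algebra_simps)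
  ultimately show ?thesis by simp
qed

lemma dflow_0 [simp]: "dflow w i j 0 x v = v"
  by (simp add: dflow_def)

lemma munit_nth: "munit a $ k $ l = (if a = (k, l) then 1 else 0)"
  by (auto simp: munit_def axis_def)

lemma pushforward_0: "pushforward w i j 0 x k l s t = bracket w k l s t x"
  by (simp add: pushforward_def munit_nth if_distrib [of "\<lambda>x. x * _"] if_distrib [of "\<lambda>x. _ * x"] cong: if_cong)

lemma continuous_on_flow [continuous_intros]:
  assumes "continuous_on S \<zeta>" "continuous_on S \<xi>"
  shows "continuous_on S (\<lambda>u. flow w i j (\<zeta> u) (\<xi> u))"
  unfolding flow_def by (intro continuous_intros assms)

lemma continuous_on_dflow [continuous_intros]:
  assumes "continuous_on S \<zeta>" "continuous_on S \<xi>" "continuous_on S \<eta>"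
  shows "continuous_on S (\<lambda>u. dflow w i j (\<zeta> u) (\<xi> u) (\<eta> u))"
  unfolding dflow_def by (intro continuous_intros assms)

text \<open>
  The bracket along the flow and the push-forward of the initial bracket solve the same linear equation
  with the same initial value. Hence the flow is a Poisson map.
\<close>

theorem flow_poisson: "bracket w k l s t (flow w i j z x) = pushforward w i j z x k l s t"
proof -
  define W :: "('a \<times> 'a) \<times> ('a \<times> 'a) \<Rightarrow> complex \<Rightarrow> complex" where
    "W = (\<lambda>((k, l), (s, t)) z. bracket w k l s t (flow w i j z x) - pushforward w i j z x k l s t)"
  define W' :: "('a \<times> 'a) \<times> ('a \<times> 'a) \<Rightarrow> complex \<Rightarrow> complex" where
    "W' = (\<lambda>((k, l), (s, t)) z. dbracket w i j k l (flow w i j z x) (\<chi> p q. W ((p, q), (s, t)) z)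
       + dbracket w i j s t (flow w i j z x) (\<chi> p q. W ((k, l), (p, q)) z))"
  have "W ((k, l), (s, t)) z = 0"
  proof (rule linear_ode_family_vanishes [where W = W and W' = W'])
    fix p :: "('a \<times> 'a) \<times> ('a \<times> 'a)" and z
    obtain k l s t where p: "p = ((k, l), (s, t))" by (metis surj_pair)
    have *: "(\<chi> p q. f p q - g p q) = (\<chi> p q. f p q) - (\<chi> p q. g p q)" for f g :: "'a \<Rightarrow> 'a \<Rightarrow> complex"
      by (simp add: vec_eq_iff)
    show "(W p has_field_derivative W' p z) (at z)"
      using DERIV_diff [OF bracket_flow_DERIV [of w k l s t i j x z] pushforward_DERIV [of w i j x k l s t z]]
      by (simp add: p W_def W'_def * dbracket_diff algebra_simps)
  next
    fix p :: "('a \<times> 'a) \<times> ('a \<times> 'a)" and r :: real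
    obtain k l s t where p: "p = ((k, l), (s, t))" by (metis surj_pair)
    have "compact ((\<lambda>z. flow w i j z x) ` cball 0 r)"
      by (intro compact_continuous_image continuous_intros compact_cball)
    then obtain B where B: "norm (flow w i j z x) \<le> B" if "norm z \<le> r" for z
      by (metis bounded_iff compact_imp_bounded imageI mem_cball_0)
    let ?K1 = "norm (ord_sgn i k + ord_sgn j l) + norm (twist w i j k l)"
    let ?K2 = "norm (ord_sgn i s + ord_sgn j t) + norm (twist w i j s t)"
    have "norm (W' p z) \<le> ((?K1 + ?K2) * (2 * B)) * (\<Sum>q\<in>UNIV. norm (W q z))" if "norm z \<le> r" for z
    proof -
      let ?y = "flow w i j z x" and ?S = "\<Sum>q\<in>UNIV. norm (W q z)"
      have S: "norm (W q z) \<le> ?S" for q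
        by (rule member_le_sum) auto
      have S0: "0 \<le> ?S" by (intro sum_nonneg) auto
      have "norm (W' p z) \<le> ?K1 * (2 * norm ?y * ?S) + ?K2 * (2 * norm ?y * ?S)"
        unfolding p W'_def prod.case
        by (intro order_trans [OF norm_triangle_ineq] add_mono dbracket_bound) (simp_all add: S)
      also have "\<dots> \<le> ?K1 * (2 * B * ?S) + ?K2 * (2 * B * ?S)"
        using B [OF that] S0 by (intro add_mono mult_left_mono mult_right_mono) auto
      finally show ?thesis by (simp add: algebra_simps)
    qed
    then show "\<exists>K. \<forall>z. norm z \<le> r \<longrightarrow> norm (W' p z) \<le> K * (\<Sum>q\<in>UNIV. norm (W q z))"
      by blast
  next
    fix p :: "('a \<times> 'a) \<times> ('a \<times> 'a)"
    show "W p 0 = 0"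
      by (auto simp: W_def pushforward_0 split: prod.split)
  qed
  then show ?thesis by (simp add: W_def)
qed

section \<open>The Hamiltonian distribution\<close>

lemma cscale_nth [simp]: "cscale c a $ s $ t = c * a $ s $ t"
  by (simp add: cscale_def map_matrix_def)

lemma clinearI:
  assumes "\<And>x y. f (x + y) = f x + f y" "\<And>c x. f (cscale c x) = cscale c (f x)"
  shows "Vector_Spaces.linear cscale cscale (f :: 'n::finite cmatrix \<Rightarrow> 'n cmatrix)"
  by unfold_locales (fact assms)+

lemma clinear_functionalI:
  assumes "\<And>x y. f (x + y) = f x + f y" "\<And>c x. f (cscale c x) = c * f x"
  shows "Vector_Spaces.linear cscale (*) (f :: 'n::finite cmatrix \<Rightarrow> complex)"
  by unfold_locales (auto simp: algebra_simps assms)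

lemma matrix_expansion: "v = (\<Sum>a\<in>UNIV. cscale (v $ fst a $ snd a) (munit a))"
  by (simp add: vec_eq_iff munit_nth if_distrib [of "\<lambda>x. _ * x"] cong: if_cong)

text \<open>
  A basis among the matrix units, which makes the theory of finite dimension available.
\<close>

definition cbasis :: "'n::finite cmatrix set" where
  "cbasis = (SOME B. B \<subseteq> range munit \<and> cmat.independent B \<and> range munit \<subseteq> cmat.span B)"

lemma cbasis:
  shows "cbasis \<subseteq> (range munit :: 'a::finite cmatrix set)"
    and "cmat.independent (cbasis :: 'a cmatrix set)"
    and "range munit \<subseteq> cmat.span (cbasis :: 'a cmatrix set)"
proof -
  obtain B :: "'a cmatrix set" where "B \<subseteq> range munit" "cmat.independent B" "range munit \<subseteq> cmat.span B"
    using cmat.maximal_independent_subset by blast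
  then have "\<exists>B :: 'a cmatrix set. B \<subseteq> range munit \<and> cmat.independent B \<and> range munit \<subseteq> cmat.span B"
    by blast
  from someI_ex [OF this] show "cbasis \<subseteq> (range munit :: 'a cmatrix set)" "cmat.independent (cbasis :: 'a cmatrix set)"
    "range munit \<subseteq> cmat.span (cbasis :: 'a cmatrix set)"
    unfolding cbasis_def by auto
qed

lemma span_munit: "cmat.span (range munit) = UNIV"
proof -
  have "v \<in> cmat.span (range munit)" for v :: "'a cmatrix"
    by (subst matrix_expansion) (intro cmat.span_sum cmat.span_scale cmat.span_base, simp)
  then show ?thesis by auto
qed

global_interpretation cmatfd: finite_dimensional_vector_space "cscale :: complex \<Rightarrow> 'n::finite cmatrix \<Rightarrow> 'n cmatrix" cbasis
proof
  show "finite (cbasis :: 'n cmatrix set)"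
    by (rule finite_subset [OF cbasis(1)]) simp
  show "cmat.independent (cbasis :: 'n cmatrix set)"
    by (rule cbasis)
  show "cmat.span (cbasis :: 'n cmatrix set) = UNIV"
    using cmat.span_minimal [OF cbasis(3) cmat.subspace_span] unfolding span_munit by (rule top.extremum_uniqueI)
qed

global_interpretation cmatpair: finite_dimensional_vector_space_pair_1
    "cscale :: complex \<Rightarrow> 'n::finite cmatrix \<Rightarrow> 'n cmatrix"
    cbasis "cscale :: complex \<Rightarrow> 'n cmatrix \<Rightarrow> 'n cmatrix" ..

text \<open>
  Only the differential of \<open>f\<close> at \<open>a\<close> enters, so the fields of the coordinate functions already span the
  distribution.
\<close>

lemma hamiltonian_field_expansion:
  "hamiltonian_field w f a = (\<Sum>i\<in>UNIV. \<Sum>j\<in>UNIV. cscale (partial i j f a) (ham w i j a))"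
proof -
  have "hamiltonian_field w f a $ p $ q = (\<Sum>i\<in>UNIV. \<Sum>j\<in>UNIV. partial i j f a * bracket w i j p q a)" for p q
  proof -
    have delta: "(\<Sum>s\<in>UNIV. \<Sum>t\<in>UNIV. F s t * (if s = p \<and> t = q then 1 else 0)) = F p q" for F :: "'a \<Rightarrow> 'a \<Rightarrow> complex"
    proof -
      have "(\<Sum>t\<in>UNIV. F s t * (if s = p \<and> t = q then 1 else 0)) = (if s = p then F s q else 0)" for s
        by (cases "s = p") (simp_all add: if_distrib [where f = "\<lambda>x. _ * x"] cong: if_cong)
      then show ?thesis by simp
    qed
    show ?thesis
      unfolding hamiltonian_field_def vec_lambda_beta poisson_def partial_coordinate delta coord_bracket_eq
      by (simp add: mult.commute)
  qed
  then show ?thesis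
    by (simp add: vec_eq_iff)
qed

lemma holomorphic_coordinate: "holomorphic_fun (\<lambda>a. a $ i $ j)"
  unfolding holomorphic_fun_def
proof (intro allI exI conjI)
  fix a
  show "((\<lambda>a. a $ i $ j) has_derivative (\<lambda>a. a $ i $ j)) (at a)"
    by (intro bounded_linear.has_derivative [OF bounded_linear_vec_nth] has_derivative_ident)
  show "Vector_Spaces.linear cscale (*) (\<lambda>a. a $ i $ j)"
    by (rule clinear_functionalI) auto
qed

lemma hamiltonian_field_coordinate: "hamiltonian_field w (\<lambda>a. a $ i $ j) a = ham w i j a"
  by (simp add: hamiltonian_field_def poisson_coordinates coord_bracket_eq ham_def)

lemma distribution_span:
  "hamiltonian_distribution w a = cmat.span (range (\<lambda>b. ham w (fst b) (snd b) a))"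
proof
  show "hamiltonian_distribution w a \<subseteq> cmat.span (range (\<lambda>b. ham w (fst b) (snd b) a))"
    unfolding hamiltonian_distribution_def
  proof (rule cmat.span_minimal [OF _ cmat.subspace_span], safe)
    fix f
    have "ham w i j a \<in> range (\<lambda>b. ham w (fst b) (snd b) a)" for i j
      by (rule image_eqI [of _ _ "(i, j)"]) auto
    then show "hamiltonian_field w f a \<in> cmat.span (range (\<lambda>b. ham w (fst b) (snd b) a))"
      unfolding hamiltonian_field_expansion
      by (intro cmat.span_sum cmat.span_scale cmat.span_base)
  qed
  show "cmat.span (range (\<lambda>b. ham w (fst b) (snd b) a)) \<subseteq> hamiltonian_distribution w a"
    unfolding hamiltonian_distribution_def
  proof (rule cmat.span_mono, safe)
    fix i j :: 'a
    show "\<exists>f. ham w (fst (i, j)) (snd (i, j)) a = hamiltonian_field w f a \<and> holomorphic_fun f"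
      using hamiltonian_field_coordinate holomorphic_coordinate by (metis fst_conv snd_conv)
  qed
qed

lemma subspace_distribution [simp]: "cmat.subspace (hamiltonian_distribution w a)"
  by (simp add: distribution_span)

lemma ham_in_distribution [simp]: "ham w i j a \<in> hamiltonian_distribution w a"
  unfolding distribution_span by (rule cmat.span_base, rule image_eqI [of _ _ "(i, j)"]) auto

lemma linear_dflow: "Vector_Spaces.linear cscale cscale (dflow w i j z x)"
  by (rule clinearI) (simp_all add: dflow_def vec_eq_iff algebra_simps)

lemma dflow_expansion: "dflow w i j z x v $ s $ t = (\<Sum>a\<in>UNIV. v $ fst a $ snd a * dflow w i j z x (munit a) $ s $ t)"
proof -
  interpret D: Vector_Spaces.linear cscale cscale "dflow w i j z x" by (rule linear_dflow)
  show ?thesis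
    by (subst matrix_expansion [of v]) (simp add: D.sum D.scale)
qed

text \<open>
  The Poisson property of the flow, read as an equation between tangent vectors: the Hamiltonian
  vectors at the end point are images of combinations of those at the initial point.
\<close>

lemma ham_flow:
  "ham w k l (flow w i j z x) =
     (\<Sum>a\<in>UNIV. cscale (dflow w i j z x (munit a) $ k $ l) (dflow w i j z x (ham w (fst a) (snd a) x)))"
  by (simp add: vec_eq_iff flow_poisson pushforward_def dflow_expansion [of _ _ _ _ _ "ham w _ _ x"] sum_distrib_left mult_ac)

lemma distribution_flow_subset:
  "hamiltonian_distribution w (flow w i j z x) \<subseteq> dflow w i j z x ` hamiltonian_distribution w x"
proof -
  interpret D: Vector_Spaces.linear cscale cscale "dflow w i j z x" by (rule linear_dflow)
  have sub: "cmat.subspace (dflow w i j z x ` hamiltonian_distribution w x)"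
    by (rule D.subspace_image) simp
  show ?thesis
    unfolding distribution_span [of w "flow w i j z x"]
  proof (rule cmat.span_minimal [OF _ sub], safe)
    fix k l
    show "ham w (fst (k, l)) (snd (k, l)) (flow w i j z x) \<in> dflow w i j z x ` hamiltonian_distribution w x"
      unfolding fst_conv snd_conv ham_flow
      by (intro cmat.subspace_sum [OF sub] cmat.subspace_scale [OF sub] imageI ham_in_distribution)
  qed
qed

text \<open>
  By \<open>distribution_flow_subset\<close> the dimension cannot increase along a flow; it cannot decrease because the
  flow can be reversed.
\<close>

lemma dim_distribution_flow:
  "cmat.dim (hamiltonian_distribution w (flow w i j z x)) = cmat.dim (hamiltonian_distribution w x)"
proof -
  have le: "cmat.dim (hamiltonian_distribution w (flow w i j z x)) \<le> cmat.dim (hamiltonian_distribution w x)" for z x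
  proof -
    have "cmat.dim (hamiltonian_distribution w (flow w i j z x)) \<le> cmat.dim (dflow w i j z x ` hamiltonian_distribution w x)"
      by (intro cmatfd.dim_subset distribution_flow_subset)
    also have "\<dots> \<le> cmat.dim (hamiltonian_distribution w x)"
      by (rule cmatpair.dim_image_le [OF linear_dflow])
    finally show ?thesis .
  qed
  show ?thesis
    using le [of z x] le [of "-z" "flow w i j z x"] by (simp add: flow_minus)
qed

text \<open>
  The flows preserve the Hamiltonian distribution. This replaces involutivity in the construction of
  the leaves, and it works although the rank of the distribution is not constant.
\<close>

lemma dflow_distribution:
  "dflow w i j z x ` hamiltonian_distribution w x = hamiltonian_distribution w (flow w i j z x)"
proof -
  interpret D: Vector_Spaces.linear cscale cscale "dflow w i j z x" by (rule linear_dflow)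
  have "hamiltonian_distribution w (flow w i j z x) = dflow w i j z x ` hamiltonian_distribution w x"
  proof (rule cmatfd.subspace_dim_equal [OF _ _ distribution_flow_subset])
    show "cmat.dim (dflow w i j z x ` hamiltonian_distribution w x) \<le> cmat.dim (hamiltonian_distribution w (flow w i j z x))"
      unfolding dim_distribution_flow by (rule cmatpair.dim_image_le [OF linear_dflow])
  qed (auto intro: D.subspace_image)
  then show ?thesis ..
qed

section \<open>Orbits of the flows\<close>

inductive_set orbit :: "'n::{finite,linorder} param \<Rightarrow> 'n cmatrix \<Rightarrow> 'n cmatrix set" for w a where
  base: "a \<in> orbit w a"
| flow: "x \<in> orbit w a \<Longrightarrow> flow w i j z x \<in> orbit w a"

lemma orbit_trans: "y \<in> orbit w x \<Longrightarrow> x \<in> orbit w a \<Longrightarrow> y \<in> orbit w a"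
  by (induction rule: orbit.induct) (auto intro: orbit.flow)

lemma orbit_sym: "x \<in> orbit w a \<Longrightarrow> a \<in> orbit w x"
proof (induction rule: orbit.induct)
  case (flow x i j z)
  have "x \<in> orbit w (flow w i j z x)"
    using orbit.flow [OF orbit.base, of w i j "-z" "flow w i j z x"] by (simp add: flow_minus)
  with flow show ?case by (blast intro: orbit_trans)
qed (rule orbit.base)

lemma orbit_eq: "x \<in> orbit w a \<Longrightarrow> orbit w x = orbit w a"
  by (blast intro: orbit_trans orbit_sym)

lemma dim_distribution_orbit:
  "x \<in> orbit w a \<Longrightarrow> cmat.dim (hamiltonian_distribution w x) = cmat.dim (hamiltonian_distribution w a)"
  by (induction rule: orbit.induct) (simp_all add: dim_distribution_flow)

section \<open>The torus\<close>

text \<open>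
  The group \<open>S_mult\<close> will turn out to consist of the scalings of rows and columns by nonzero numbers.
\<close>

definition torus :: "('n::finite \<Rightarrow> complex) \<Rightarrow> ('n \<Rightarrow> complex) \<Rightarrow> 'n cmatrix \<Rightarrow> 'n cmatrix" where
  "torus r k x = (\<chi> s t. r s * k t * x $ s $ t)"

lemma torus_nth [simp]: "torus r k x $ s $ t = r s * k t * x $ s $ t"
  by (simp add: torus_def)

lemma torus_torus: "torus r k (torus r' k' x) = torus (\<lambda>s. r s * r' s) (\<lambda>t. k t * k' t) x"
  by (simp add: vec_eq_iff)

text \<open>
  The bracket is homogeneous under scalings of rows and columns, so the torus conjugates a flow into the
  same flow at another time.
\<close>

lemma torus_flow:
  assumes "r i \<noteq> 0" "k j \<noteq> 0"
  shows "torus r k (flow w i j z x) = flow w i j (z / (r i * k j)) (torus r k x)"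
proof -
  have flow_int: "flow_int q (z / (r i * k j)) (r i * k j * c) = flow_int q z c / (r i * k j)" for q c
    using assms by (simp add: flow_int_def)
  have "r s * k t * (e * (x $ s $ t + x $ i $ t * x $ s $ j * g))
    = e * (r s * k t * x $ s $ t + r i * k t * x $ i $ t * (r s * k j * x $ s $ j) * (g / (r i * k j)))" for s t e g
    using assms by (simp add: field_simps)
  moreover have "z / (r i * k j) * (r i * k j * x $ i $ j) = z * x $ i $ j"
    using assms by simp
  ultimately show ?thesis
    by (simp only: vec_eq_iff flow_nth torus_nth flow_int) simp
qed

text \<open>
  The twist enters the flow only as a factor \<open>exp (z a\<^sub>i\<^sub>j (f s + g t))\<close>, which for a given matrix and a given
  time is an element of the torus.
\<close>

lemma flow_change_param:
  "\<exists>r k. (\<forall>s. r s \<noteq> 0) \<and> (\<forall>t. k t \<noteq> 0) \<and> flow w' i j z x = torus r k (flow w i j z x)"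
proof -
  let ?c = "z * x $ i $ j"
  let ?r = "\<lambda>s. exp (?c * (twist w' i j s j - twist w i j s j))" and ?k = "\<lambda>t. exp (?c * (twist w' i j i t - twist w i j i t))"
  have "exp (?c * twist w' i j s t) = ?r s * ?k t * exp (?c * twist w i j s t)" for s t
    unfolding twist_cross [of _ i j t s, symmetric] by (simp add: exp_add [symmetric] algebra_simps)
  then have "flow w' i j z x = torus ?r ?k (flow w i j z x)"
    by (simp add: vec_eq_iff flow_nth)
  then show ?thesis
    by (intro exI [of _ ?r] exI [of _ ?k]) simp
qed

text \<open>
  The functions that are constant above a point and \<open>1\<close> elsewhere generate, together with the constants,
  all functions without zeros: their quotients are the functions that differ from \<open>1\<close> at one point only.
\<close>

lemma nonvanishing_functions_generated:
  fixes r :: "'n::{finite,linorder} \<Rightarrow> complex"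
  assumes const: "\<And>c. c \<noteq> 0 \<Longrightarrow> P (\<lambda>s. c)"
    and step: "\<And>k i c. k < i \<Longrightarrow> c \<noteq> 0 \<Longrightarrow> P (\<lambda>s. if k < s then c else 1)"
    and mult: "\<And>f g. P f \<Longrightarrow> P g \<Longrightarrow> P (\<lambda>s. f s * g s)"
    and r: "\<And>s. r s \<noteq> 0"
  shows "P r"
proof -
  have above: "P (\<lambda>s. if k < s then c else 1)" if "c \<noteq> 0" for k c
  proof (cases "\<exists>i. k < i")
    case False
    then have "(\<lambda>s. if k < s then c else 1) = (\<lambda>s. 1)" by auto
    then show ?thesis using const [of 1] by simp
  qed (use step that in blast)
  \<comment> \<open>The condition \<open>k \<le> s\<close> is \<open>m < s\<close> for the predecessor \<open>m\<close> of \<open>k\<close>; for minimal \<open>k\<close> it always holds.\<close>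
  have atleast: "P (\<lambda>s. if k \<le> s then c else 1)" if "c \<noteq> 0" for k c
  proof (cases "\<exists>j. j < k")
    case True
    define m where "m = Max {j. j < k}"
    have "m \<in> {j. j < k}"
      unfolding m_def using True by (intro Max_in) auto
    moreover have "j \<le> m" if "j < k" for j
      unfolding m_def using that by (intro Max_ge) auto
    ultimately have "m < s \<longleftrightarrow> k \<le> s" for s
      by (metis leD less_le_trans linorder_not_le mem_Collect_eq)
    then show ?thesis using above [OF that, of m] by simp
  next
    case False
    then have "(\<lambda>s. if k \<le> s then c else 1) = (\<lambda>s. c)" by (auto simp: not_less)
    then show ?thesis using const [OF that] by simp
  qed
  have point: "P (\<lambda>s. if s = k then c else 1)" if "c \<noteq> 0" for k c
  proof -
    have "(\<lambda>s. if s = k then c else 1) = (\<lambda>s. (if k \<le> s then c else 1) * (if k < s then inverse c else 1))"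
      using that by (auto simp: fun_eq_iff)
    then show ?thesis
      using mult [OF atleast above, of c "inverse c" k k] that by simp
  qed
  have "P (\<lambda>s. if s \<in> A then r s else 1)" if "finite A" for A
    using that
  proof (induction A)
    case empty
    then show ?case using const [of 1] by simp
  next
    case (insert k A)
    have "(\<lambda>s. if s \<in> insert k A then r s else 1) = (\<lambda>s. (if s = k then r k else 1) * (if s \<in> A then r s else 1))"
      using insert by (auto simp: fun_eq_iff)
    then show ?case
      using mult [OF point [OF r, of k k] insert.IH] by simp
  qed
  from this [of UNIV] show ?thesis by simp
qed

lemma check_lam_torus:
  "check_lam Beta c = torus (\<lambda>s. c) (\<lambda>t. 1)"
  "check_lam (Mu k) c = torus (\<lambda>s. if k < s then c else 1) (\<lambda>t. 1)"
  "check_lam (Nu k) c = torus (\<lambda>s. 1) (\<lambda>t. if k < t then c else 1)"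
  by (simp_all add: fun_eq_iff check_lam_def vec_eq_iff)

lemma mult_BijGroup_UNIV:
  "bij f \<Longrightarrow> bij g \<Longrightarrow> f \<otimes>\<^bsub>BijGroup UNIV\<^esub> g = f \<circ> g"
  by (auto simp: BijGroup_def Bij_def compose_def fun_eq_iff)

lemma S_mult_bij: "g \<in> S_mult \<Longrightarrow> bij g"
proof -
  assume "g \<in> S_mult"
  then have "g \<in> carrier (BijGroup UNIV)"
    unfolding S_mult_def
    by (rule group.generate_in_carrier [OF group_BijGroup, rotated]) (auto intro: check_lam_in_BijGroup)
  then show ?thesis by (simp add: BijGroup_def Bij_def)
qed

lemma S_mult_comp:
  assumes "f \<in> S_mult" "g \<in> S_mult"
  shows "f \<circ> g \<in> S_mult"
proof -
  have "f \<otimes>\<^bsub>BijGroup UNIV\<^esub> g \<in> S_mult"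
    using assms unfolding S_mult_def by (rule generate.eng)
  then show ?thesis
    unfolding mult_BijGroup_UNIV [OF assms [THEN S_mult_bij]] .
qed

lemma check_lam_in_S_mult: "b \<in> gens \<Longrightarrow> c \<noteq> 0 \<Longrightarrow> check_lam b c \<in> S_mult"
  unfolding S_mult_def by (intro generate.incl) auto

lemma torus_in_S_mult:
  fixes r k :: "'n::{finite,linorder} \<Rightarrow> complex"
  assumes "\<And>s. r s \<noteq> 0" "\<And>t. k t \<noteq> 0"
  shows "torus r k \<in> S_mult"
proof -
  have comp: "torus r k \<circ> torus r' k' = torus (\<lambda>s. r s * r' s) (\<lambda>t. k t * k' t)" for r k r' k' :: "'n \<Rightarrow> complex"
    by (simp add: fun_eq_iff torus_torus)
  have 1: "torus r (\<lambda>t. 1) \<in> S_mult"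
  proof (rule nonvanishing_functions_generated [where P = "\<lambda>r. torus r (\<lambda>t. 1) \<in> S_mult"])
    show "torus (\<lambda>s. c) (\<lambda>t::'n. 1) \<in> S_mult" if "c \<noteq> 0" for c
      using check_lam_in_S_mult [of Beta c] that by (simp add: check_lam_torus gens_def)
    show "torus (\<lambda>s. if m < s then c else 1) (\<lambda>t. 1) \<in> S_mult" if "m < i" "c \<noteq> 0" for m i :: 'n and c
      using check_lam_in_S_mult [of "Mu m" c] that by (auto simp: check_lam_torus gens_def)
    show "torus (\<lambda>s. f s * g s) (\<lambda>t. 1) \<in> S_mult"
      if "torus f (\<lambda>t. 1) \<in> S_mult" "torus g (\<lambda>t. 1) \<in> S_mult" for f g :: "'n \<Rightarrow> complex"
      using S_mult_comp [OF that] by (simp add: comp)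
  qed (rule assms)
  have 2: "torus (\<lambda>s. 1) k \<in> S_mult"
  proof (rule nonvanishing_functions_generated [where P = "\<lambda>k. torus (\<lambda>s. 1) k \<in> S_mult"])
    \<comment> \<open>Scaling all columns is scaling all rows, which is the action of \<open>Beta\<close>.\<close>
    show "torus (\<lambda>s. 1) (\<lambda>t::'n. c) \<in> S_mult" if "c \<noteq> 0" for c
    proof -
      have "torus (\<lambda>s. 1) (\<lambda>t. c) = torus (\<lambda>s. c) (\<lambda>t::'n. 1)"
        by (simp add: fun_eq_iff vec_eq_iff)
      then show ?thesis
        using check_lam_in_S_mult [of "Beta :: 'n gen" c] that by (simp add: check_lam_torus gens_def)
    qed
    show "torus (\<lambda>s. 1) (\<lambda>t. if m < t then c else 1) \<in> S_mult" if "m < i" "c \<noteq> 0" for m i :: 'n and c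
      using check_lam_in_S_mult [of "Nu m" c] that by (auto simp: check_lam_torus gens_def)
    show "torus (\<lambda>s. 1) (\<lambda>t. f t * g t) \<in> S_mult"
      if "torus (\<lambda>s. 1) f \<in> S_mult" "torus (\<lambda>s. 1) g \<in> S_mult" for f g :: "'n \<Rightarrow> complex"
      using S_mult_comp [OF that] by (simp add: comp)
  qed (rule assms)
  show ?thesis
    using S_mult_comp [OF 1 2] by (simp add: comp)
qed

lemma S_mult_torus:
  assumes "g \<in> S_mult"
  shows "\<exists>r k. (\<forall>s. r s \<noteq> 0) \<and> (\<forall>t. k t \<noteq> 0) \<and> g = torus r k"
proof -
  define Q :: "('a cmatrix \<Rightarrow> 'a cmatrix) \<Rightarrow> bool"
    where "Q g \<longleftrightarrow> (\<exists>r k. (\<forall>s. r s \<noteq> 0) \<and> (\<forall>t. k t \<noteq> 0) \<and> g = torus r k)" for g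
  have QI: "Q (torus r k)" if "\<And>s. r s \<noteq> 0" "\<And>t. k t \<noteq> 0" for r k
    using that unfolding Q_def by blast
  have lam: "Q (check_lam b c)" if "c \<noteq> 0" for b c
    by (cases b) (simp_all add: check_lam_torus, (rule QI; simp add: that)+)
  have "Q g"
    using assms unfolding S_mult_def
  proof (induction rule: generate.induct)
    case one
    have "\<one>\<^bsub>BijGroup UNIV\<^esub> = torus (\<lambda>s::'a. 1) (\<lambda>t. 1)"
      by (simp add: BijGroup_def fun_eq_iff vec_eq_iff)
    then show ?case using QI [of "\<lambda>s. 1" "\<lambda>t. 1"] by simp
  next
    case (incl h)
    then show ?case using lam by auto
  next
    case (inv h)
    then obtain b c where h: "h = check_lam b c" "c \<noteq> 0" by blast
    have bij: "bij (check_lam b c)" if "c \<noteq> 0" for c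
      using check_lam_in_BijGroup [OF that, of b] by (simp add: BijGroup_def Bij_def)
    have "check_lam b (inverse c) \<circ> h = (\<lambda>x. x)"
      using h by (simp add: fun_eq_iff check_lam_def vec_eq_iff power_int_inverse)
    then have "check_lam b (inverse c) \<otimes>\<^bsub>BijGroup UNIV\<^esub> h = \<one>\<^bsub>BijGroup UNIV\<^esub>"
      using mult_BijGroup_UNIV [OF bij bij, of "inverse c" c] h by (simp add: BijGroup_def restrict_def)
    then have "inv\<^bsub>BijGroup UNIV\<^esub> h = check_lam b (inverse c)"
      using h check_lam_in_BijGroup by (intro group.inv_equality [OF group_BijGroup]) auto
    then show ?case using lam h by simp
  next
    case (eng h1 h2)
    then have "h1 \<in> S_mult" "h2 \<in> S_mult" by (auto simp: S_mult_def)
    then have h12: "h1 \<otimes>\<^bsub>BijGroup UNIV\<^esub> h2 = h1 \<circ> h2"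
      by (intro mult_BijGroup_UNIV S_mult_bij)
    obtain r k where h1: "h1 = torus r k" and rk: "\<And>s. r s \<noteq> 0" "\<And>t. k t \<noteq> 0"
      using eng.IH(1) by (auto simp: Q_def)
    obtain r' k' where h2: "h2 = torus r' k'" and rk': "\<And>s. r' s \<noteq> 0" "\<And>t. k' t \<noteq> 0"
      using eng.IH(2) by (auto simp: Q_def)
    have "h1 \<otimes>\<^bsub>BijGroup UNIV\<^esub> h2 = torus (\<lambda>s. r s * r' s) (\<lambda>t. k t * k' t)"
      unfolding h12 unfolding h1 h2 by (simp add: fun_eq_iff torus_torus)
    then show ?case using rk rk' QI [of "\<lambda>s. r s * r' s" "\<lambda>t. k t * k' t"] by simp
  qed
  then show ?thesis unfolding Q_def .
qed

text \<open>
  The heart of the comparison of two parameters. A step of the \<open>w'\<close>-orbit is a step of the \<open>w\<close>-orbit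
  followed by an element of the torus, and the torus elements collected so far can be moved past the flows.
\<close>

lemma torus_orbit_invariant:
  fixes a :: "'n::{finite,linorder} cmatrix"
  shows "(\<Union>g\<in>S_mult. g ` orbit w' a) \<subseteq> (\<Union>g\<in>S_mult. g ` orbit w a)"
proof safe
  fix g :: "'n cmatrix \<Rightarrow> 'n cmatrix" and y assume g: "g \<in> S_mult" and "y \<in> orbit w' a"
  from \<open>y \<in> orbit w' a\<close> have "\<exists>h\<in>S_mult. \<exists>x\<in>orbit w a. y = h x"
  proof (induction rule: orbit.induct)
    case base
    have "torus (\<lambda>s. 1) (\<lambda>t. 1) \<in> S_mult" by (intro torus_in_S_mult) auto
    moreover have "a = torus (\<lambda>s. 1) (\<lambda>t. 1) a" by (simp add: vec_eq_iff)
    ultimately show ?case using orbit.base by blast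
  next
    case (flow y i j z)
    then obtain h x where h: "h \<in> S_mult" and x: "x \<in> orbit w a" and y: "y = h x" by blast
    obtain r k where rk: "\<And>s. r s \<noteq> 0" "\<And>t. k t \<noteq> 0" "h = torus r k"
      using S_mult_torus [OF h] by blast
    obtain r' k' where rk': "\<And>s. r' s \<noteq> 0" "\<And>t. k' t \<noteq> 0" "flow w' i j z y = torus r' k' (flow w i j z y)"
      using flow_change_param by blast
    have "h (flow w i j (z * (r i * k j)) x) = flow w i j z y"
      using rk by (simp add: y torus_flow)
    then have "flow w' i j z y = (torus r' k' \<circ> h) (flow w i j (z * (r i * k j)) x)"
      by (simp add: rk')
    moreover have "torus r' k' \<circ> h \<in> S_mult"
      by (intro S_mult_comp torus_in_S_mult rk' h)
    ultimately show ?case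
      using orbit.flow [OF x] by blast
  qed
  then obtain h x where "h \<in> S_mult" "x \<in> orbit w a" "y = h x" by blast
  then show "g y \<in> (\<Union>g\<in>S_mult. g ` orbit w a)"
    using S_mult_comp [OF g, of h] by (intro UN_I [of "g \<circ> h"]) auto
qed

section \<open>Curves along the leaves and the leaf topology\<close>

text \<open>
  Curves tangent to the distribution, along which its rank stays constant. Without the condition on the
  rank, a curve may leave a leaf: a point at which the distribution vanishes is a leaf, and a tangent
  curve may start there with velocity zero and go elsewhere.
\<close>

definition leaf_curve :: "'n::{finite,linorder} param \<Rightarrow> (real \<Rightarrow> 'n cmatrix) \<Rightarrow> bool" where
  "leaf_curve w \<gamma> \<longleftrightarrow>
     (\<forall>t\<in>{0..1}. \<exists>v\<in>hamiltonian_distribution w (\<gamma> t). (\<gamma> has_vector_derivative v) (at t within {0..1})) \<and>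
     (\<forall>t\<in>{0..1}. cmat.dim (hamiltonian_distribution w (\<gamma> t)) = cmat.dim (hamiltonian_distribution w (\<gamma> 0)))"

text \<open>
  The leaf topology on the whole space of matrices: a neighbourhood of \<open>p\<close> need only catch the end points of
  the short curves along the leaf of \<open>p\<close>. No charts are involved, so the topology axioms, the comparison
  with the Euclidean topology and the continuity of tangent maps are immediate.
\<close>

definition leaf_topology :: "'n::{finite,linorder} param \<Rightarrow> 'n cmatrix topology" where
  "leaf_topology w = topology (\<lambda>W. \<forall>p\<in>W. \<exists>e>0. \<forall>\<gamma>.
     leaf_curve w \<gamma> \<and> \<gamma> 0 = p \<and> \<gamma> ` {0..1} \<subseteq> ball p e \<longrightarrow> \<gamma> 1 \<in> W)"

lemma openin_leaf_topology:
  "openin (leaf_topology w) W \<longleftrightarrow> (\<forall>p\<in>W. \<exists>e>0. \<forall>\<gamma>.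
     leaf_curve w \<gamma> \<and> \<gamma> 0 = p \<and> \<gamma> ` {0..1} \<subseteq> ball p e \<longrightarrow> \<gamma> 1 \<in> W)"
proof -
  let ?P = "\<lambda>W p e. \<forall>\<gamma>. leaf_curve w \<gamma> \<and> \<gamma> 0 = p \<and> \<gamma> ` {0..1} \<subseteq> ball p e \<longrightarrow> \<gamma> 1 \<in> W"
  have "istopology (\<lambda>W. \<forall>p\<in>W. \<exists>e>0. ?P W p e)"
    unfolding istopology_def
  proof (intro conjI allI impI ballI)
    fix S T p assume "\<forall>p\<in>S. \<exists>e>0. ?P S p e" "\<forall>p\<in>T. \<exists>e>0. ?P T p e" "p \<in> S \<inter> T"
    then obtain d e where "d > 0" "?P S p d" "e > 0" "?P T p e" by (metis IntD1 IntD2)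
    then show "\<exists>e>0. ?P (S \<inter> T) p e"
      by (intro exI [of _ "min d e"]) (auto simp: subset_iff)
  next
    fix K p assume "\<forall>S\<in>K. \<forall>p\<in>S. \<exists>e>0. ?P S p e" "p \<in> \<Union>K"
    then obtain S e where "S \<in> K" "e > 0" "?P S p e" by blast
    then show "\<exists>e>0. ?P (\<Union>K) p e" by blast
  qed
  then show ?thesis
    unfolding leaf_topology_def by (simp add: topology_inverse')
qed

lemma open_imp_openin_leaf_topology:
  assumes "open S"
  shows "openin (leaf_topology w) S"
  unfolding openin_leaf_topology
proof
  fix p assume "p \<in> S"
  then obtain e where e: "e > 0" "ball p e \<subseteq> S" using assms open_contains_ball by blast
  have "\<gamma> 1 \<in> S" if "\<gamma> ` {0..1} \<subseteq> ball p e" for \<gamma> :: "real \<Rightarrow> 'a cmatrix"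
    using that e by (meson atLeastAtMost_iff image_subset_iff order_refl subsetD zero_le_one)
  with e show "\<exists>e>0. \<forall>\<gamma>. leaf_curve w \<gamma> \<and> \<gamma> 0 = p \<and> \<gamma> ` {0..1} \<subseteq> ball p e \<longrightarrow> \<gamma> 1 \<in> S"
    by blast
qed

lemma topspace_leaf_topology [simp]: "topspace (leaf_topology w) = UNIV"
  using openin_subset [OF open_imp_openin_leaf_topology [OF open_UNIV, of w]] by (rule top.extremum_uniqueI)

text \<open>
  Maps from an open subset of a linear space that are tangent to the leaves. The domain is a type of its own,
  since it has to range over tangent spaces, the time line, and products of these.
\<close>

definition leafwise :: "'n::{finite,linorder} param \<Rightarrow> 'a::real_normed_vector set \<Rightarrow> 'a set \<Rightarrow> ('a \<Rightarrow> 'n cmatrix) \<Rightarrow> bool" where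
  "leafwise w V U G \<longleftrightarrow>
     (\<forall>u\<in>U. \<exists>G'. (G has_derivative G') (at u within V) \<and> G' ` V \<subseteq> hamiltonian_distribution w (G u)) \<and>
     (\<forall>u\<in>U. \<forall>v\<in>U. cmat.dim (hamiltonian_distribution w (G u)) = cmat.dim (hamiltonian_distribution w (G v)))"

lemma leafwise_dim:
  "leafwise w V U G \<Longrightarrow> u \<in> U \<Longrightarrow> v \<in> U \<Longrightarrow>
    cmat.dim (hamiltonian_distribution w (G u)) = cmat.dim (hamiltonian_distribution w (G v))"
  unfolding leafwise_def by blast

lemma leafwise_segment:
  assumes V: "subspace V" and UV: "U \<subseteq> V" and G: "leafwise w V U G" and seg: "closed_segment u v \<subseteq> U"
  shows "leaf_curve w (\<lambda>t. G (u + t *\<^sub>R (v - u)))"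
proof -
  let ?l = "\<lambda>t. u + t *\<^sub>R (v - u)"
  have l: "?l t \<in> U" if "t \<in> {0..1}" for t
    using seg that by (force simp: closed_segment_def algebra_simps)
  have uv: "v - u \<in> V"
    using seg UV by (auto intro!: subspace_diff [OF V])
  show ?thesis
    unfolding leaf_curve_def
  proof (intro conjI ballI)
    fix t :: real assume t: "t \<in> {0..1}"
    then obtain G' where G': "(G has_derivative G') (at (?l t) within V)"
        "G' ` V \<subseteq> hamiltonian_distribution w (G (?l t))"
      using G l unfolding leafwise_def by blast
    have "(?l has_derivative (\<lambda>h. h *\<^sub>R (v - u))) (at t within {0..1})"
      by (auto intro!: derivative_eq_intros)
    moreover have "(G has_derivative G') (at (?l t) within ?l ` {0..1})"
      by (rule has_derivative_subset [OF G'(1)]) (use l UV in blast)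
    ultimately have "((\<lambda>t. G (?l t)) has_derivative (\<lambda>h. G' (h *\<^sub>R (v - u)))) (at t within {0..1})"
      by (rule has_derivative_in_compose)
    moreover have "G' (h *\<^sub>R (v - u)) = h *\<^sub>R G' (v - u)" for h
      using has_derivative_linear [OF G'(1)] by (rule linear_scale)
    ultimately have "((\<lambda>t. G (?l t)) has_vector_derivative G' (v - u)) (at t within {0..1})"
      by (simp add: has_vector_derivative_def)
    then show "\<exists>x\<in>hamiltonian_distribution w (G (?l t)). ((\<lambda>t. G (?l t)) has_vector_derivative x) (at t within {0..1})"
      using G' uv by blast
    show "cmat.dim (hamiltonian_distribution w (G (?l t))) = cmat.dim (hamiltonian_distribution w (G (?l 0)))"
      by (rule leafwise_dim [OF G l [OF t] l]) simp
  qed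
qed

text \<open>
  Nearby points of the domain are joined by a segment, whose image is a short curve along a leaf.
\<close>

lemma leafwise_continuous:
  assumes V: "subspace V" and U: "openin (top_of_set V) U" and G: "leafwise w V U G"
  shows "continuous_map (top_of_set U) (leaf_topology w) G"
  unfolding continuous_map
proof (intro conjI allI impI)
  have UV: "U \<subseteq> V" using U openin_imp_subset by blast
  fix W assume W: "openin (leaf_topology w) W"
  have "\<exists>d>0. ball x d \<inter> U \<subseteq> {u \<in> U. G u \<in> W}" if x: "x \<in> U" "G x \<in> W" for x
  proof -
    obtain e where e: "e > 0" "\<And>\<gamma>. leaf_curve w \<gamma> \<Longrightarrow> \<gamma> 0 = G x \<Longrightarrow> \<gamma> ` {0..1} \<subseteq> ball (G x) e \<Longrightarrow> \<gamma> 1 \<in> W"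
      using W [unfolded openin_leaf_topology, THEN bspec, OF x(2)] by blast
    obtain G' where "(G has_derivative G') (at x within V)"
      using G x unfolding leafwise_def by blast
    then have "continuous (at x within V) G"
      by (rule has_derivative_continuous)
    then obtain d1 where d1: "d1 > 0" "\<And>y. y \<in> V \<Longrightarrow> dist y x < d1 \<Longrightarrow> dist (G y) (G x) < e"
      using e(1) unfolding continuous_within_eps_delta by blast
    obtain d2 where d2: "d2 > 0" "ball x d2 \<inter> V \<subseteq> U"
      using U x by (meson openin_contains_ball)
    let ?d = "min d1 d2"
    have "G y \<in> W" if y: "y \<in> ball x ?d \<inter> U" for y
    proof -
      have seg: "closed_segment x y \<subseteq> ball x ?d \<inter> V"
        using x y UV d1(1) d2(1) convex_Int [OF convex_ball subspace_imp_convex [OF V]]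
        by (intro closed_segment_subset) auto
      have sub: "ball x ?d \<subseteq> ball x d1" "ball x ?d \<subseteq> ball x d2"
        by (simp_all add: subset_ball)
      have curve: "leaf_curve w (\<lambda>t. G (x + t *\<^sub>R (y - x)))"
        by (rule leafwise_segment [OF V UV G]) (use seg sub d2(2) in blast)
      have "G (x + t *\<^sub>R (y - x)) \<in> ball (G x) e" if "t \<in> {0..1}" for t
      proof -
        have "x + t *\<^sub>R (y - x) \<in> closed_segment x y"
          using that by (force simp: closed_segment_def algebra_simps)
        then have "x + t *\<^sub>R (y - x) \<in> V" "x + t *\<^sub>R (y - x) \<in> ball x d1"
          using seg sub(1) by blast+
        then show ?thesis
          using d1(2) by (metis dist_commute mem_ball)
      qed
      then have "(\<lambda>t. G (x + t *\<^sub>R (y - x))) ` {0..1} \<subseteq> ball (G x) e"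
        by blast
      from e(2) [OF curve _ this] show ?thesis by simp
    qed
    then show ?thesis
      using d1(1) d2(1) by (intro exI [of _ ?d]) auto
  qed
  then show "openin (top_of_set U) {x \<in> topspace (top_of_set U). G x \<in> W}"
    by (auto simp: openin_contains_ball)
qed simp

section \<open>Flow boxes\<close>

lemma clinear_imp_bounded_linear:
  assumes "Vector_Spaces.linear cscale cscale (f :: 'n::finite cmatrix \<Rightarrow> 'n cmatrix)"
  shows "bounded_linear f"
proof -
  interpret f: Vector_Spaces.linear cscale cscale f by fact
  have "r *\<^sub>R x = cscale (of_real r) x" for r and x :: "'n cmatrix"
    by (simp add: vec_eq_iff scaleR_conv_of_real [where 'a = complex])
  then have "linear f"
    by (intro linearI) (simp_all add: f.add f.scale)
  then show ?thesis by (simp add: linear_conv_bounded_linear)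
qed

lemma clinear_functional_imp_bounded_linear:
  assumes "Vector_Spaces.linear cscale (*) (f :: 'n::finite cmatrix \<Rightarrow> complex)"
  shows "bounded_linear f"
proof -
  interpret f: Vector_Spaces.linear cscale "(*)" f by fact
  have "r *\<^sub>R x = cscale (of_real r) x" for r and x :: "'n cmatrix"
    by (simp add: vec_eq_iff scaleR_conv_of_real [where 'a = complex])
  then have "linear f"
    by (intro linearI) (simp_all add: f.add f.scale scaleR_conv_of_real)
  then show ?thesis by (simp add: linear_conv_bounded_linear)
qed

text \<open>
  Coordinates near \<open>p\<close>. The linear map \<open>q\<close> takes the component of \<open>x\<close> transversal to the distribution at \<open>p\<close>;
  the point is first moved from \<open>p\<close> by this component, and then by the flows belonging to the
  basis vectors \<open>b\<close> of the distribution at \<open>p\<close>, with the coordinates \<open>\<zeta> b x\<close> of \<open>x\<close> as times.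
\<close>

primrec boxmap where
  "boxmap w \<kappa> \<zeta> p q [] x = p + q x"
| "boxmap w \<kappa> \<zeta> p q (b # bs) x = flow w (fst (\<kappa> b)) (snd (\<kappa> b)) (\<zeta> b x) (boxmap w \<kappa> \<zeta> p q bs x)"

primrec dboxmap where
  "dboxmap w \<kappa> \<zeta> p q [] x v = q v"
| "dboxmap w \<kappa> \<zeta> p q (b # bs) x v =
     cscale (\<zeta> b v) (ham w (fst (\<kappa> b)) (snd (\<kappa> b)) (boxmap w \<kappa> \<zeta> p q (b # bs) x))
     + dflow w (fst (\<kappa> b)) (snd (\<kappa> b)) (\<zeta> b x) (boxmap w \<kappa> \<zeta> p q bs x) (dboxmap w \<kappa> \<zeta> p q bs x v)"

locale box_data =
  fixes w :: "'n::{finite,linorder} param" and \<kappa> :: "'n cmatrix \<Rightarrow> 'n \<times> 'n"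
    and \<zeta> :: "'n cmatrix \<Rightarrow> 'n cmatrix \<Rightarrow> complex" and p :: "'n cmatrix" and q :: "'n cmatrix \<Rightarrow> 'n cmatrix"
  assumes lin_\<zeta>: "Vector_Spaces.linear cscale (*) (\<zeta> b)"
    and lin_q: "Vector_Spaces.linear cscale cscale q"
    and q_zero: "q v = 0 \<longleftrightarrow> v \<in> hamiltonian_distribution w p"
begin

abbreviation "F \<equiv> boxmap w \<kappa> \<zeta> p q"
abbreviation "F' \<equiv> dboxmap w \<kappa> \<zeta> p q"

lemma F_has_derivative: "(F bs has_derivative F' bs x) (at x)"
proof (induction bs)
  case Nil
  show ?case
    using bounded_linear.has_derivative [OF clinear_imp_bounded_linear [OF lin_q] has_derivative_ident]
    by (auto intro!: derivative_eq_intros)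
next
  case (Cons b bs)
  have "(\<zeta> b has_derivative \<zeta> b) (at x)"
    by (rule bounded_linear_imp_has_derivative [OF clinear_functional_imp_bounded_linear [OF lin_\<zeta>]])
  from flow_has_derivative [OF this Cons.IH] show ?case by simp
qed

lemma continuous_F: "continuous_on UNIV (F bs)"
  by (meson F_has_derivative has_derivative_continuous continuous_at_imp_continuous_on)

lemma continuous_F': "continuous_on UNIV (\<lambda>x. F' bs x v)"
proof (induction bs)
  case (Cons b bs)
  have 1: "continuous_on UNIV (\<zeta> b)"
    by (rule linear_continuous_on [OF clinear_functional_imp_bounded_linear [OF lin_\<zeta>]])
  show ?case
    by (simp add: cscale_def map_matrix_def ham_def bracket_def) (intro continuous_intros 1 continuous_F Cons.IH)
qed simp

lemma linear_F': "Vector_Spaces.linear cscale cscale (F' bs x)"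
proof (induction bs)
  case Nil
  show ?case using lin_q by simp
next
  case (Cons b bs)
  interpret d: Vector_Spaces.linear cscale cscale "F' bs x" by fact
  interpret z: Vector_Spaces.linear cscale "(*)" "\<zeta> b" by (rule lin_\<zeta>)
  interpret f: Vector_Spaces.linear cscale cscale "dflow w (fst (\<kappa> b)) (snd (\<kappa> b)) (\<zeta> b x) (F bs x)"
    by (rule linear_dflow)
  show ?case
    by (rule clinearI) (simp_all add: d.add z.add f.add d.scale z.scale f.scale cmat.scale_left_distrib cmat.scale_right_distrib)
qed

text \<open>
  Vectors in the distribution at \<open>p\<close> do not change the transversal component, so they only change
  flow times; and the flows preserve the distribution.
\<close>

lemma F'_tangent: "v \<in> hamiltonian_distribution w p \<Longrightarrow> F' bs x v \<in> hamiltonian_distribution w (F bs x)"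
proof (induction bs)
  case Nil
  then show ?case using q_zero [of v] cmat.subspace_0 [OF subspace_distribution] by simp
next
  case (Cons b bs)
  then show ?case
    using dflow_distribution [of w "fst (\<kappa> b)" "snd (\<kappa> b)" "\<zeta> b x" "F bs x"]
    by (auto intro!: cmat.subspace_add [OF subspace_distribution] cmat.subspace_scale [OF subspace_distribution])
qed

lemma F_orbit: "x \<in> hamiltonian_distribution w p \<Longrightarrow> F bs x \<in> orbit w p"
proof (induction bs)
  case Nil
  then have "q x = 0" by (simp only: q_zero)
  then show ?case by (simp add: orbit.base)
qed (simp add: orbit.flow)

lemma \<zeta>_0: "\<zeta> b 0 = 0"
proof -
  interpret z: Vector_Spaces.linear cscale "(*)" "\<zeta> b" by (rule lin_\<zeta>)
  show ?thesis by (rule z.zero)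
qed

lemma F_0: "F bs 0 = p"
proof (induction bs)
  case Nil
  have "q 0 = 0" unfolding q_zero by (simp add: cmat.subspace_0)
  then show ?case by simp
qed (simp add: \<zeta>_0)

text \<open>
  For a basis of the distribution at \<open>p\<close> together with its coordinate functions, the right-hand side is \<open>v\<close>,
  and the inverse function theorem applies.
\<close>

lemma F'_0:
  assumes "\<And>b. b \<in> set bs \<Longrightarrow> ham w (fst (\<kappa> b)) (snd (\<kappa> b)) p = b" "distinct bs"
  shows "F' bs 0 v = q v + (\<Sum>b\<in>set bs. cscale (\<zeta> b v) b)"
  using assms
proof (induction bs)
  case (Cons b bs)
  then show ?case by (simp add: F_0 \<zeta>_0 del: boxmap.simps) 
qed simp

end

text \<open>
  A chart \<open>\<psi>\<close> of the orbit of \<open>p\<close>, defined on a piece \<open>N\<close> of the tangent space at \<open>p\<close>, with a continuous left inverse \<open>g\<close>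
  on a Euclidean neighbourhood \<open>V\<close>. The last clause is the point: a curve along the leaves that starts in
  the plaque \<open>\<psi> ` N\<close> cannot leave the plaque without leaving \<open>V\<close>.
\<close>

definition plaque_box :: "'n::{finite,linorder} param \<Rightarrow> 'n cmatrix \<Rightarrow> ('n cmatrix \<Rightarrow> 'n cmatrix) \<Rightarrow> 'n cmatrix set \<Rightarrow>
    'n cmatrix set \<Rightarrow> ('n cmatrix \<Rightarrow> 'n cmatrix) \<Rightarrow> bool" where
  "plaque_box w p \<psi> N V g \<longleftrightarrow>
     openin (top_of_set (hamiltonian_distribution w p)) N \<and> 0 \<in> N \<and> \<psi> 0 = p \<and> \<psi> ` N \<subseteq> orbit w p \<and>
     open V \<and> \<psi> ` N \<subseteq> V \<and> continuous_on V g \<and> (\<forall>u\<in>N. g (\<psi> u) = u) \<and>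
     (\<forall>u\<in>N. \<exists>\<psi>'. (\<psi> has_derivative \<psi>') (at u within hamiltonian_distribution w p) \<and>
        Vector_Spaces.linear cscale cscale \<psi>' \<and> inj_on \<psi>' (hamiltonian_distribution w p) \<and>
        \<psi>' ` hamiltonian_distribution w p = hamiltonian_distribution w (\<psi> u)) \<and>
     (\<forall>\<gamma>. leaf_curve w \<gamma> \<longrightarrow> \<gamma> 0 \<in> \<psi> ` N \<longrightarrow> \<gamma> ` {0..1} \<subseteq> V \<longrightarrow> \<gamma> 1 \<in> \<psi> ` N)"

text \<open>
  In the coordinates given by \<open>boxmap\<close>, the distribution contains the image of the tangent space of \<open>p\<close>, and
  equals it wherever the rank is that at \<open>p\<close>. So along a curve of that rank the
  transversal component \<open>q\<close> has derivative \<open>0\<close>.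
\<close>

lemma plaque_box_exists: "\<exists>\<psi> N V g. plaque_box w p \<psi> N V g"
proof -
  let ?D = "hamiltonian_distribution w"
  obtain B0 where B0: "B0 \<subseteq> range (\<lambda>b. ham w (fst b) (snd b) p)" "cmat.independent B0"
      "range (\<lambda>b. ham w (fst b) (snd b) p) \<subseteq> cmat.span B0"
    using cmat.maximal_independent_subset by blast
  have span: "cmat.span B0 = ?D p"
    unfolding distribution_span
    using cmat.span_mono [OF B0(1)] cmat.span_minimal [OF B0(3) cmat.subspace_span] by (rule antisym)
  have "finite B0" using B0(2) by (rule cmatfd.finiteI_independent)
  then obtain bs where bs: "set bs = B0" "distinct bs" using finite_distinct_list by blast
  have "\<exists>a. ham w (fst a) (snd a) p = b" if "b \<in> B0" for b
    using B0(1) that by blast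
  then obtain \<kappa> where \<kappa>: "\<And>b. b \<in> B0 \<Longrightarrow> ham w (fst (\<kappa> b)) (snd (\<kappa> b)) p = b"
    by metis
  define B where "B = cmat.extend_basis B0"
  have B: "B0 \<subseteq> B" "cmat.independent B" "cmat.span B = UNIV"
    unfolding B_def using B0(2) by (auto simp: cmat.extend_basis_superset cmat.independent_extend_basis cmat.span_extend_basis)
  define \<zeta> where "\<zeta> b x = cmat.representation B x b" for b x
  define q where "q x = x - (\<Sum>b\<in>B0. cscale (\<zeta> b x) b)" for x
  have lin_\<zeta>: "Vector_Spaces.linear cscale (*) (\<zeta> b)" for b
    by (rule clinear_functionalI) (simp_all add: \<zeta>_def cmat.representation_add cmat.representation_scale B)
  have lin_q: "Vector_Spaces.linear cscale cscale q"
  proof (rule clinearI)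
    fix x y c
    interpret z: Vector_Spaces.linear cscale "(*)" "\<zeta> b" for b by (rule lin_\<zeta>)
    show "q (x + y) = q x + q y"
      by (simp add: q_def z.add cmat.scale_left_distrib sum.distrib)
    show "q (cscale c x) = cscale c (q x)"
      by (simp add: q_def z.scale cmat.scale_right_diff_distrib cmat.scale_sum_right)
  qed
  interpret q: Vector_Spaces.linear cscale cscale q by (rule lin_q)
  have q_zero: "q v = 0 \<longleftrightarrow> v \<in> ?D p" for v
  proof
    assume "q v = 0"
    then have "v = (\<Sum>b\<in>B0. cscale (\<zeta> b v) b)" by (simp add: q_def)
    also have "\<dots> \<in> cmat.span B0"
      by (intro cmat.span_sum cmat.span_scale cmat.span_base)
    finally show "v \<in> ?D p" by (simp add: span)
  next
    assume "v \<in> ?D p"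
    then have "v \<in> cmat.span B0" by (simp add: span)
    moreover have "q c = 0" if "c \<in> B0" for c
    proof -
      have "\<zeta> b c = (if b = c then 1 else 0)" for b
        using cmat.representation_basis [OF B(2), of c] that B(1) by (auto simp: \<zeta>_def)
      then have "(\<Sum>b\<in>B0. cscale (\<zeta> b c) b) = (\<Sum>b\<in>B0. if b = c then c else 0)"
        by (intro sum.cong) auto
      then show ?thesis
        using that \<open>finite B0\<close> by (simp add: q_def)
    qed
    ultimately show "q v = 0"
      by (induction rule: cmat.span_induct_alt) (simp_all add: q.zero q.add q.scale)
  qed
  interpret box_data w \<kappa> \<zeta> p q
    using lin_\<zeta> lin_q q_zero by (rule box_data.intro)
  define f' where "f' x = Blinfun (F' bs x)" for x
  have f': "blinfun_apply (f' x) = F' bs x" for x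
    unfolding f'_def by (rule bounded_linear_Blinfun_apply [OF clinear_imp_bounded_linear [OF linear_F']])
  have "F' bs 0 v = v" for v
    using F'_0 [of bs v] \<kappa> bs by (simp add: q_def)
  then have inv: "id_blinfun o\<^sub>L f' 0 = id_blinfun"
    by (intro blinfun_eqI) (simp add: f')
  have cont: "continuous_on UNIV f'"
    by (rule continuous_on_blinfun_componentwise) (simp add: f' continuous_F')
  obtain U V g g' where U: "open U" "0 \<in> U" and V: "open V"
    and hom: "homeomorphism U V (F bs) g"
    and g': "\<And>y. y \<in> V \<Longrightarrow> (g has_derivative g' y) (at y)"
    and g'_inv: "\<And>y. y \<in> V \<Longrightarrow> g' y = inv_into UNIV (F' bs (g y))"
    and bij: "\<And>y. y \<in> V \<Longrightarrow> bij (F' bs (g y))"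
    using inverse_function_theorem [OF open_UNIV _ cont UNIV_I inv, of "F bs"] F_has_derivative
    unfolding f' by metis
  have FU: "F bs u \<in> V" "g (F bs u) = u" if "u \<in> U" for u
    using hom that by (auto simp: homeomorphism_def)
  have gV: "g y \<in> U" "F bs (g y) = y" if "y \<in> V" for y
    using hom that by (auto simp: homeomorphism_def)
  have inj: "inj (F' bs u)" if "u \<in> U" for u
    using bij [OF FU(1) [OF that]] FU(2) [OF that] by (simp add: bij_is_inj)
  define N where "N = ?D p \<inter> U"
  have img: "F' bs u ` ?D p = ?D (F bs u)" if u: "u \<in> U" and d: "cmat.dim (?D (F bs u)) = cmat.dim (?D p)" for u
  proof (rule cmatfd.subspace_dim_equal)
    interpret l: Vector_Spaces.linear cscale cscale "F' bs u" by (rule linear_F')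
    show "cmat.subspace (F' bs u ` ?D p)" by (rule l.subspace_image) simp
    have "cmat.dim (F' bs u ` ?D p) = cmat.dim (?D p)"
      by (rule cmatpair.dim_image_eq [OF linear_F']) (use inj [OF u] in \<open>auto intro: inj_on_subset\<close>)
    then show "cmat.dim (?D (F bs u)) \<le> cmat.dim (F' bs u ` ?D p)" using d by simp
  qed (auto intro: F'_tangent)
  have "plaque_box w p (F bs) N V g"
    unfolding plaque_box_def
  proof (intro conjI ballI allI impI)
    show "openin (top_of_set (?D p)) N" unfolding N_def using U(1) by (rule openin_open_Int)
    show "0 \<in> N" by (simp add: N_def U cmat.subspace_0)
    show "F bs 0 = p" by (rule F_0)
    show "F bs ` N \<subseteq> orbit w p" by (auto simp: N_def intro: F_orbit)
    show "open V" by fact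
    show "F bs ` N \<subseteq> V" using FU by (auto simp: N_def)
    show "continuous_on V g" using hom by (simp add: homeomorphism_def)
    show "g (F bs u) = u" if "u \<in> N" for u using FU that by (auto simp: N_def)
    show "\<exists>\<psi>'. (F bs has_derivative \<psi>') (at u within ?D p) \<and> Vector_Spaces.linear cscale cscale \<psi>' \<and>
        inj_on \<psi>' (?D p) \<and> \<psi>' ` ?D p = ?D (F bs u)" if "u \<in> N" for u
    proof (intro exI conjI)
      show "(F bs has_derivative F' bs u) (at u within ?D p)"
        by (rule has_derivative_at_withinI [OF F_has_derivative])
      show "Vector_Spaces.linear cscale cscale (F' bs u)" by (rule linear_F')
      show "inj_on (F' bs u) (?D p)" using inj that by (auto simp: N_def intro: inj_on_subset)
      show "F' bs u ` ?D p = ?D (F bs u)"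
        using that by (intro img dim_distribution_orbit F_orbit) (auto simp: N_def)
    qed
  next
    fix \<gamma> assume curve: "leaf_curve w \<gamma>" and start: "\<gamma> 0 \<in> F bs ` N" and inV: "\<gamma> ` {0..1} \<subseteq> V"
    have \<gamma>V: "\<gamma> t \<in> V" if "t \<in> {0..1}" for t using inV that by blast
    obtain u0 where u0: "u0 \<in> N" "\<gamma> 0 = F bs u0" using start by blast
    have dim0: "cmat.dim (?D (\<gamma> 0)) = cmat.dim (?D p)"
      unfolding u0(2) using u0(1) by (intro dim_distribution_orbit F_orbit) (auto simp: N_def)
    have "((\<lambda>t. q (g (\<gamma> t))) has_vector_derivative 0) (at t within {0..1})" if t: "t \<in> {0..1}" for t
    proof -
      obtain v where v: "v \<in> ?D (\<gamma> t)" "(\<gamma> has_vector_derivative v) (at t within {0..1})"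
        using curve t unfolding leaf_curve_def by blast
      have "cmat.dim (?D (\<gamma> t)) = cmat.dim (?D p)"
        using curve t dim0 unfolding leaf_curve_def by simp
      then have "F' bs (g (\<gamma> t)) ` ?D p = ?D (\<gamma> t)"
        using img [of "g (\<gamma> t)"] gV [OF \<gamma>V [OF t]] by simp
      then obtain e where e: "e \<in> ?D p" "v = F' bs (g (\<gamma> t)) e" using v(1) by blast
      \<comment> \<open>The velocity read in box coordinates is a vector of the tangent space at \<open>p\<close>, on which \<open>q\<close> vanishes.\<close>
      have ge: "g' (\<gamma> t) v = e"
        unfolding g'_inv [OF \<gamma>V [OF t]] e(2)
        by (rule inv_f_f [OF bij_is_inj [OF bij [OF \<gamma>V [OF t]]]])
      have "((\<lambda>t. g (\<gamma> t)) has_derivative (\<lambda>h. g' (\<gamma> t) (h *\<^sub>R v))) (at t within {0..1})"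
        by (rule has_derivative_compose [OF v(2) [unfolded has_vector_derivative_def] g' [OF \<gamma>V [OF t]]])
      from bounded_linear.has_derivative [OF clinear_imp_bounded_linear [OF lin_q] this]
      have "((\<lambda>t. q (g (\<gamma> t))) has_derivative (\<lambda>h. q (g' (\<gamma> t) (h *\<^sub>R v)))) (at t within {0..1})" .
      moreover have "q (g' (\<gamma> t) (h *\<^sub>R v)) = h *\<^sub>R 0" for h
        using linear_scale [OF has_derivative_linear [OF g' [OF \<gamma>V [OF t]]], of h v]
          linear_scale [OF bounded_linear.linear [OF clinear_imp_bounded_linear [OF lin_q]], of h e]
          q_zero [of e] e(1) ge by simp
      ultimately show ?thesis
        by (simp add: has_vector_derivative_def)
    qed
    then obtain c where c: "\<And>t. t \<in> {0..1} \<Longrightarrow> q (g (\<gamma> t)) = c"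
      using has_vector_derivative_zero_constant [of "{0..1::real}" "\<lambda>t. q (g (\<gamma> t))"] by auto
    have "q (g (\<gamma> 1)) = q (g (\<gamma> 0))" using c [of 0] c [of 1] by simp
    also have "g (\<gamma> 0) = u0" using u0 FU by (simp add: N_def)
    also have "q u0 = 0" using u0(1) by (simp add: q_zero N_def)
    finally have "g (\<gamma> 1) \<in> ?D p" by (simp add: q_zero)
    then have "g (\<gamma> 1) \<in> N" using gV \<gamma>V [of 1] by (simp add: N_def)
    then show "\<gamma> 1 \<in> F bs ` N"
      using gV(2) [OF \<gamma>V [of 1]] by (intro image_eqI [of _ _ "g (\<gamma> 1)"]) auto
  qed
  then show ?thesis by blast
qed

section \<open>Orbits are integral manifolds\<close>

lemma csubspace_imp_subspace: "cmat.subspace V \<Longrightarrow> subspace V"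
proof -
  assume V: "cmat.subspace V"
  have "r *\<^sub>R x = cscale (of_real r) x" for r and x :: "'a cmatrix"
    by (simp add: vec_eq_iff scaleR_conv_of_real [where 'a = complex])
  then show ?thesis
    using V by (simp add: subspace_def cmat.subspace_def)
qed

context
  fixes w :: "'n::{finite,linorder} param" and p \<psi> N V g
  assumes box: "plaque_box w p \<psi> N V g"
begin

lemma plaque_box_N: "openin (top_of_set (hamiltonian_distribution w p)) N" "0 \<in> N" "\<psi> 0 = p" "\<psi> ` N \<subseteq> orbit w p"
  and plaque_box_g: "open V" "\<psi> ` N \<subseteq> V" "continuous_on V g" "\<And>u. u \<in> N \<Longrightarrow> g (\<psi> u) = u"
  and plaque_box_deriv: "u \<in> N \<Longrightarrow> \<exists>\<psi>'. (\<psi> has_derivative \<psi>') (at u within hamiltonian_distribution w p) \<and>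
        Vector_Spaces.linear cscale cscale \<psi>' \<and> inj_on \<psi>' (hamiltonian_distribution w p) \<and>
        \<psi>' ` hamiltonian_distribution w p = hamiltonian_distribution w (\<psi> u)"
  and plaque_box_curve: "leaf_curve w \<gamma> \<Longrightarrow> \<gamma> 0 \<in> \<psi> ` N \<Longrightarrow> \<gamma> ` {0..1} \<subseteq> V \<Longrightarrow> \<gamma> 1 \<in> \<psi> ` N"
  using box unfolding plaque_box_def by blast+

lemma plaque_leafwise: "leafwise w (hamiltonian_distribution w p) N \<psi>"
  unfolding leafwise_def
proof (intro conjI ballI)
  show "\<exists>G'. (\<psi> has_derivative G') (at u within hamiltonian_distribution w p) \<and>
      G' ` hamiltonian_distribution w p \<subseteq> hamiltonian_distribution w (\<psi> u)" if "u \<in> N" for u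
    using plaque_box_deriv [OF that] by blast
  have "cmat.dim (hamiltonian_distribution w (\<psi> u)) = cmat.dim (hamiltonian_distribution w p)" if "u \<in> N" for u
    by (rule dim_distribution_orbit) (use that plaque_box_N in blast)
  then show "cmat.dim (hamiltonian_distribution w (\<psi> u)) = cmat.dim (hamiltonian_distribution w (\<psi> v))"
    if "u \<in> N" "v \<in> N" for u v
    using that by simp
qed

text \<open>
  A leaf curve that starts in the plaque and stays in the box ends in the plaque, and the continuous
  inverse of the chart controls where.
\<close>

lemma openin_plaque:
  assumes N': "openin (top_of_set (hamiltonian_distribution w p)) N'" "N' \<subseteq> N"
  shows "openin (leaf_topology w) (\<psi> ` N')"
  unfolding openin_leaf_topology
proof
  fix y assume "y \<in> \<psi> ` N'"
  then obtain u where u: "u \<in> N'" "y = \<psi> u" by blast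
  obtain S where S: "open S" "N' = hamiltonian_distribution w p \<inter> S"
    using N'(1) by (auto simp: openin_open)
  have "open (g -` S \<inter> V)"
    using plaque_box_g(1,3) S(1) by (simp add: continuous_on_open_vimage)
  moreover have "y \<in> g -` S \<inter> V"
    using u N'(2) plaque_box_g S by auto
  ultimately obtain e where e: "e > 0" "ball y e \<subseteq> g -` S \<inter> V"
    by (meson open_contains_ball)
  have "\<gamma> 1 \<in> \<psi> ` N'" if \<gamma>: "leaf_curve w \<gamma>" "\<gamma> 0 = y" "\<gamma> ` {0..1} \<subseteq> ball y e" for \<gamma>
  proof -
    have "\<gamma> 1 \<in> \<psi> ` N"
      by (rule plaque_box_curve) (use \<gamma> u N'(2) e(2) in auto)
    then obtain v where v: "v \<in> N" "\<gamma> 1 = \<psi> v" by blast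
    have "\<gamma> 1 \<in> ball y e" using \<gamma>(3) by (auto simp: image_subset_iff)
    then have "g (\<gamma> 1) \<in> S" using e(2) by blast
    then have "v \<in> S" using v plaque_box_g by simp
    moreover have "v \<in> hamiltonian_distribution w p"
      using v(1) openin_imp_subset [OF plaque_box_N(1)] by blast
    ultimately show ?thesis using v(2) S(2) by blast
  qed
  with e(1) show "\<exists>e>0. \<forall>\<gamma>. leaf_curve w \<gamma> \<and> \<gamma> 0 = y \<and> \<gamma> ` {0..1} \<subseteq> ball y e \<longrightarrow> \<gamma> 1 \<in> \<psi> ` N'"
    by blast
qed

lemma plaque_homeomorphic_map:
  "homeomorphic_map (top_of_set N) (subtopology (leaf_topology w) (\<psi> ` N)) \<psi>"
proof (rule bijective_open_imp_homeomorphic_map)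
  show "continuous_map (top_of_set N) (subtopology (leaf_topology w) (\<psi> ` N)) \<psi>"
    by (intro continuous_map_into_subtopology leafwise_continuous [OF _ plaque_box_N(1) plaque_leafwise]
        csubspace_imp_subspace) auto
  show "open_map (top_of_set N) (subtopology (leaf_topology w) (\<psi> ` N)) \<psi>"
    unfolding open_map_def
  proof (intro allI impI)
    fix S assume "openin (top_of_set N) S"
    then have S: "openin (top_of_set (hamiltonian_distribution w p)) S" "S \<subseteq> N"
      using openin_trans plaque_box_N(1) openin_imp_subset by blast+
    then show "openin (subtopology (leaf_topology w) (\<psi> ` N)) (\<psi> ` S)"
      using openin_plaque [OF S] S(2) unfolding openin_subtopology by blast
  qed
  show "\<psi> ` topspace (top_of_set N) = topspace (subtopology (leaf_topology w) (\<psi> ` N))" by simp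
  show "inj_on \<psi> (topspace (top_of_set N))"
    by (simp add: inj_on_def) (metis plaque_box_g(4))
qed

end

lemma openin_orbit: "openin (leaf_topology w) (orbit w a)"
proof (subst openin_subopen, intro ballI)
  fix p assume p: "p \<in> orbit w a"
  obtain \<psi> N V g where box: "plaque_box w p \<psi> N V g" using plaque_box_exists by blast
  have "openin (leaf_topology w) (\<psi> ` N)"
    by (rule openin_plaque [OF box plaque_box_N(1) [OF box] subset_refl])
  moreover have "p \<in> \<psi> ` N" using plaque_box_N(2,3) [OF box] by force
  moreover have "\<psi> ` N \<subseteq> orbit w a" using plaque_box_N(4) [OF box] orbit_eq [OF p] by simp
  ultimately show "\<exists>T. openin (leaf_topology w) T \<and> p \<in> T \<and> T \<subseteq> orbit w a" by blast
qed

definition orbit_topology :: "'n::{finite,linorder} param \<Rightarrow> 'n cmatrix \<Rightarrow> 'n cmatrix topology" where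
  "orbit_topology w a = subtopology (leaf_topology w) (orbit w a)"

lemma topspace_orbit_topology [simp]: "topspace (orbit_topology w a) = orbit w a"
  by (simp add: orbit_topology_def)

lemma openin_orbit_topology:
  "openin (orbit_topology w a) U \<longleftrightarrow> openin (leaf_topology w) U \<and> U \<subseteq> orbit w a"
  unfolding orbit_topology_def by (rule openin_open_subtopology [OF openin_orbit])

lemma Hausdorff_orbit_topology: "Hausdorff_space (orbit_topology w a)"
proof -
  have "Hausdorff_space (leaf_topology w)"
    unfolding Hausdorff_space_def
  proof (intro allI impI)
    fix x y assume "x \<in> topspace (leaf_topology w) \<and> y \<in> topspace (leaf_topology w) \<and> x \<noteq> y"
    then obtain U V where "open U" "open V" "x \<in> U" "y \<in> V" "U \<inter> V = {}" using hausdorff by metis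
    then show "\<exists>U V. openin (leaf_topology w) U \<and> openin (leaf_topology w) V \<and> x \<in> U \<and> y \<in> V \<and> disjnt U V"
      unfolding disjnt_def by (blast intro: open_imp_openin_leaf_topology)
  qed
  then show ?thesis
    unfolding orbit_topology_def by (rule Hausdorff_space_subtopology)
qed

lemma flow_leafwise: "leafwise w UNIV UNIV (\<lambda>z. flow w i j z x)"
  unfolding leafwise_def
proof (intro conjI ballI)
  fix z v :: complex
  have "((\<lambda>z. flow w i j z x) has_derivative
      (\<lambda>e. cscale e (ham w i j (flow w i j z x)) + dflow w i j z x 0)) (at z)"
    by (rule flow_has_derivative) (auto intro: has_derivative_ident has_derivative_const)
  moreover have "dflow w i j z x 0 = 0"
    by (simp add: dflow_def vec_eq_iff)
  ultimately show "\<exists>G'. ((\<lambda>z. flow w i j z x) has_derivative G') (at z) \<and> range G' \<subseteq> hamiltonian_distribution w (flow w i j z x)"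
    by (intro exI conjI) (auto intro!: cmat.subspace_scale)
  show "cmat.dim (hamiltonian_distribution w (flow w i j z x)) = cmat.dim (hamiltonian_distribution w (flow w i j v x))"
    by (simp add: dim_distribution_flow)
qed

text \<open>
  A clopen set that contains a point contains its images under each flow, as the time line is connected.
\<close>

lemma connected_orbit_topology: "connected_space (orbit_topology w a)"
  unfolding connected_space_clopen_in
proof (intro allI impI)
  fix W assume W: "openin (orbit_topology w a) W \<and> closedin (orbit_topology w a) W"
  have step: "flow w i j z x \<in> W" if x: "x \<in> W" for x i j z
  proof -
    have xa: "x \<in> orbit w a" using W x openin_subset by fastforce
    have "continuous_map euclidean (leaf_topology w) (\<lambda>z. flow w i j z x)"
      using leafwise_continuous [OF subspace_UNIV _ flow_leafwise] by simp
    then have cont: "continuous_map euclidean (orbit_topology w a) (\<lambda>z. flow w i j z x)"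
      unfolding orbit_topology_def using xa by (intro continuous_map_into_subtopology) (auto intro: orbit.flow)
    have "open {z. flow w i j z x \<in> W}" "closed {z. flow w i j z x \<in> W}"
      using openin_continuous_map_preimage [OF cont] closedin_continuous_map_preimage [OF cont] W
      by simp_all
    then have "{z. flow w i j z x \<in> W} = {} \<or> {z. flow w i j z x \<in> W} = UNIV"
      unfolding clopen [symmetric] by simp
    moreover have "0 \<in> {z. flow w i j z x \<in> W}" using x by simp
    ultimately show ?thesis by blast
  qed
  show "W = {} \<or> W = topspace (orbit_topology w a)"
  proof (cases "W = {}")
    case False
    then obtain x where x: "x \<in> W" by blast
    then have "x \<in> orbit w a" using W openin_subset by fastforce
    moreover have "y \<in> W" if "y \<in> orbit w x" for y
      using that by induction (use x step in auto)
    ultimately have "orbit w a \<subseteq> W" by (auto simp: orbit_eq)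
    then show ?thesis using W openin_subset by fastforce
  qed simp
qed

lemma plaque_flow_leafwise:
  assumes box: "plaque_box w p \<psi> N V g"
  shows "leafwise w (UNIV \<times> hamiltonian_distribution w p) (UNIV \<times> N) (\<lambda>x. flow w i j (fst x) (\<psi> (snd x)))"
  unfolding leafwise_def
proof (intro conjI ballI)
  let ?D = "hamiltonian_distribution w"
  fix x assume x: "x \<in> (UNIV :: complex set) \<times> N"
  then obtain \<psi>' where \<psi>': "(\<psi> has_derivative \<psi>') (at (snd x) within ?D p)" "\<psi>' ` ?D p = ?D (\<psi> (snd x))"
    using plaque_box_deriv [OF box, of "snd x"] by auto
  have 1: "(snd has_derivative snd) (at x within UNIV \<times> ?D p)"
    by (rule has_derivative_snd [OF has_derivative_ident])
  have 2: "(fst has_derivative fst) (at x within UNIV \<times> ?D p)"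
    by (rule has_derivative_fst [OF has_derivative_ident])
  have "((\<lambda>x. \<psi> (snd x)) has_derivative (\<lambda>e. \<psi>' (snd e))) (at x within UNIV \<times> ?D p)"
    by (rule has_derivative_in_compose [OF 1 has_derivative_subset [OF \<psi>'(1)]]) auto
  from flow_has_derivative [OF 2 this]
  have "((\<lambda>x. flow w i j (fst x) (\<psi> (snd x))) has_derivative
     (\<lambda>e. cscale (fst e) (ham w i j (flow w i j (fst x) (\<psi> (snd x)))) + dflow w i j (fst x) (\<psi> (snd x)) (\<psi>' (snd e))))
     (at x within UNIV \<times> ?D p)" .
  moreover have "cscale (fst e) (ham w i j (flow w i j (fst x) (\<psi> (snd x)))) + dflow w i j (fst x) (\<psi> (snd x)) (\<psi>' (snd e))
     \<in> ?D (flow w i j (fst x) (\<psi> (snd x)))" if "e \<in> UNIV \<times> ?D p" for e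
  proof (intro cmat.subspace_add [OF subspace_distribution] cmat.subspace_scale [OF subspace_distribution] ham_in_distribution)
    have "\<psi>' (snd e) \<in> ?D (\<psi> (snd x))" using that \<psi>'(2) by auto
    then show "dflow w i j (fst x) (\<psi> (snd x)) (\<psi>' (snd e)) \<in> ?D (flow w i j (fst x) (\<psi> (snd x)))"
      unfolding dflow_distribution [symmetric] by blast
  qed
  ultimately show "\<exists>G'. ((\<lambda>x. flow w i j (fst x) (\<psi> (snd x))) has_derivative G') (at x within UNIV \<times> ?D p) \<and>
      G' ` (UNIV \<times> ?D p) \<subseteq> ?D (flow w i j (fst x) (\<psi> (snd x)))"
    by (intro exI conjI image_subsetI)
next
  fix x y assume "x \<in> (UNIV :: complex set) \<times> N" "y \<in> (UNIV :: complex set) \<times> N"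
  then show "cmat.dim (hamiltonian_distribution w (flow w i j (fst x) (\<psi> (snd x)))) =
      cmat.dim (hamiltonian_distribution w (flow w i j (fst y) (\<psi> (snd y))))"
    unfolding dim_distribution_flow by (intro leafwise_dim [OF plaque_leafwise [OF box]]) auto
qed

text \<open>
  The points that one flow reaches from a plaque are parametrised by the time and the plaque, hence by a
  second countable space; so the Lindelof property applies to the inverse images of plaques.
\<close>

lemma flow_plaque_countable_cover:
  assumes box: "\<And>p. plaque_box w p (\<psi> p) (N p) (V p) (g p)"
  shows "\<exists>E. countable E \<and> (\<forall>x\<in>\<psi> p ` N p. \<forall>z. flow w i j z x \<in> (\<Union>c\<in>E. \<psi> c ` N c))"
proof -
  let ?S = "(UNIV :: complex set) \<times> N p"
  let ?f = "\<lambda>x. flow w i j (fst x) (\<psi> p (snd x))"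
  let ?P = "\<lambda>c. {x \<in> ?S. ?f x \<in> \<psi> c ` N c}"
  have cont: "continuous_map (top_of_set ?S) (leaf_topology w) ?f"
  proof (rule leafwise_continuous [OF _ _ plaque_flow_leafwise [OF box]])
    show "subspace (UNIV \<times> hamiltonian_distribution w p)"
      by (intro subspace_Times subspace_UNIV csubspace_imp_subspace) simp
    show "openin (top_of_set (UNIV \<times> hamiltonian_distribution w p)) ?S"
      by (intro openin_Times plaque_box_N(1) [OF box]) simp
  qed
  have op: "openin (leaf_topology w) (\<psi> c ` N c)" for c
    by (rule openin_plaque [OF box plaque_box_N(1) [OF box] subset_refl])
  define Q where "Q c = ?P c" for c
  have opQ: "openin (top_of_set ?S) T" if T: "T \<in> range Q" for T
  proof -
    obtain c where "T = Q c" using T by blast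
    then show ?thesis
      using openin_continuous_map_preimage [OF cont op [of c]] by (simp add: Q_def)
  qed
  have "\<exists>\<F>. \<F> \<subseteq> range Q \<and> countable \<F> \<and> \<Union>\<F> = \<Union>(range Q)"
    by (rule Lindelof_openin [OF opQ]) (assumption | intro exI conjI)+
  then obtain \<F> where \<F>: "\<F> \<subseteq> range Q" "countable \<F>" "\<Union>\<F> = \<Union>(range Q)"
    by blast
  then obtain E where E: "countable E" "\<F> = Q ` E"
    using countable_subset_image [of \<F> Q UNIV] by auto
  have "flow w i j z (\<psi> p u) \<in> (\<Union>c\<in>E. \<psi> c ` N c)" if u: "u \<in> N p" for z u
  proof -
    have "flow w i j z (\<psi> p u) \<in> \<psi> (flow w i j z (\<psi> p u)) ` N (flow w i j z (\<psi> p u))"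
      using plaque_box_N(2,3) [OF box [of "flow w i j z (\<psi> p u)"]] by (metis image_eqI)
    then have "(z, u) \<in> Q (flow w i j z (\<psi> p u))"
      using u by (simp add: Q_def)
    then have "(z, u) \<in> \<Union>\<F>" unfolding \<F>(3) by blast
    then obtain c where "c \<in> E" "(z, u) \<in> Q c" unfolding E(2) by blast
    then show ?thesis by (auto simp: Q_def)
  qed
  then show ?thesis using E(1) by blast
qed

text \<open>
  Start with one plaque and iterate \<open>flow_plaque_countable_cover\<close>, for all pairs of indices.
\<close>

lemma orbit_countable_cover:
  assumes box: "\<And>p. plaque_box w p (\<psi> p) (N p) (V p) (g p)"
  shows "\<exists>C. countable C \<and> orbit w a \<subseteq> (\<Union>c\<in>C. \<psi> c ` N c)"
proof -
  define E where "E p i j = (SOME E. countable E \<and>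
      (\<forall>x\<in>\<psi> p ` N p. \<forall>z. flow w i j z x \<in> (\<Union>c\<in>E. \<psi> c ` N c)))" for p i j
  have E: "countable (E p i j) \<and> (\<forall>x\<in>\<psi> p ` N p. \<forall>z. flow w i j z x \<in> (\<Union>c\<in>E p i j. \<psi> c ` N c))" for p i j
    unfolding E_def by (rule someI_ex [OF flow_plaque_countable_cover [OF box]])
  \<comment> \<open>The centres of the plaques that are needed for words of \<open>m\<close> flows.\<close>
  define C where "C = rec_nat {a} (\<lambda>_ C. \<Union>p\<in>C. \<Union>i\<in>UNIV. \<Union>j\<in>UNIV. E p i j)"
  have C0: "C 0 = {a}" and CS: "C (Suc m) = (\<Union>p\<in>C m. \<Union>i\<in>UNIV. \<Union>j\<in>UNIV. E p i j)" for m
    by (simp_all add: C_def)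
  have "countable (C m)" for m
    by (induction m) (auto simp: C0 CS E intro!: countable_UN)
  then have "countable (\<Union>m. C m)" by (intro countable_UN) auto
  moreover have "x \<in> (\<Union>c\<in>(\<Union>m. C m). \<psi> c ` N c)" if "x \<in> orbit w a" for x
    using that
  proof induction
    case base
    have "a \<in> \<psi> a ` N a" using plaque_box_N(2,3) [OF box [of a]] by (metis image_eqI)
    moreover have "a \<in> C 0" by (simp add: C0)
    ultimately show ?case by blast
  next
    case (flow x i j z)
    then obtain m p where "p \<in> C m" "x \<in> \<psi> p ` N p" by blast
    have "E p i j \<subseteq> C (Suc m)" using \<open>p \<in> C m\<close> unfolding CS by blast
    moreover have "flow w i j z x \<in> (\<Union>c\<in>E p i j. \<psi> c ` N c)" using E \<open>x \<in> \<psi> p ` N p\<close> by blast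
    ultimately show ?case by blast
  qed
  ultimately show ?thesis by blast
qed

lemma second_countable_orbit_topology: "second_countable (orbit_topology w a)"
proof -
  have "\<forall>p. \<exists>\<psi> N V g. plaque_box w p \<psi> N V g"
    by (intro allI plaque_box_exists)
  then obtain \<psi> N V g where box: "\<And>p. plaque_box w p (\<psi> p) (N p) (V p) (g p)"
    unfolding choice_iff by blast
  obtain C where C: "countable C" "orbit w a \<subseteq> (\<Union>c\<in>C. \<psi> c ` N c)"
    using orbit_countable_cover [OF box] by blast
  obtain \<B> :: "'a cmatrix set set" where \<B>: "countable \<B>" "\<And>b. b \<in> \<B> \<Longrightarrow> open b"
      "\<And>S. open S \<Longrightarrow> \<exists>U\<subseteq>\<B>. S = \<Union>U"
    using univ_second_countable by (metis)
  define \<A> where "\<A> = (\<lambda>(c, b). orbit w a \<inter> \<psi> c ` (N c \<inter> b)) ` (C \<times> \<B>)"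
  show ?thesis
    unfolding second_countable_def
  proof (intro exI conjI allI impI ballI)
    show "countable \<A>" unfolding \<A>_def using C(1) \<B>(1) by simp
    show "openin (orbit_topology w a) A" if A: "A \<in> \<A>" for A
    proof -
      obtain c b where A: "A = orbit w a \<inter> \<psi> c ` (N c \<inter> b)" "b \<in> \<B>" using A unfolding \<A>_def by auto
      have "openin (leaf_topology w) (\<psi> c ` (N c \<inter> b))"
        by (intro openin_plaque [OF box] openin_Int_open plaque_box_N(1) [OF box] \<B> A) simp
      then show ?thesis
        unfolding A(1) orbit_topology_def by (rule openin_subtopology_Int2)
    qed
    fix U x assume Ux: "openin (orbit_topology w a) U \<and> x \<in> U"
    have U: "openin (leaf_topology w) U" "U \<subseteq> orbit w a"
      using Ux unfolding openin_orbit_topology by blast+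
    then obtain c u where c: "c \<in> C" "u \<in> N c" "x = \<psi> c u" using C(2) Ux by blast
    have "openin (top_of_set (N c)) {v \<in> N c. \<psi> c v \<in> U}"
      using openin_continuous_map_preimage [OF leafwise_continuous [OF _ plaque_box_N(1) [OF box] plaque_leafwise [OF box]] U(1)]
      by (simp add: csubspace_imp_subspace)
    then obtain S where S: "open S" "{v \<in> N c. \<psi> c v \<in> U} = N c \<inter> S" by (auto simp: openin_open)
    then obtain b where b: "b \<in> \<B>" "u \<in> b" "b \<subseteq> S"
      using \<B>(3) [OF S(1)] c Ux by blast
    show "\<exists>V\<in>\<A>. x \<in> V \<and> V \<subseteq> U"
    proof (intro bexI conjI)
      show "orbit w a \<inter> \<psi> c ` (N c \<inter> b) \<in> \<A>" unfolding \<A>_def using c(1) b(1) by force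
      show "x \<in> orbit w a \<inter> \<psi> c ` (N c \<inter> b)" using c b Ux U(2) by blast
      show "orbit w a \<inter> \<psi> c ` (N c \<inter> b) \<subseteq> U" using S(2) b(3) by blast
    qed
  qed
qed

section \<open>Leaves and loaves\<close>

lemma orbit_connected_integral_manifold:
  fixes w :: "'n::{finite,linorder} param"
  shows "connected_integral_manifold (hamiltonian_distribution w) (orbit w a)"
  unfolding connected_integral_manifold_def
proof (intro conjI exI)
  show "orbit w a \<noteq> {}" using orbit.base by blast
  show "topspace (orbit_topology w a) = orbit w a" by simp
  show "connected_space (orbit_topology w a)" by (rule connected_orbit_topology)
  show "integral_manifold (hamiltonian_distribution w) (orbit_topology w a)"
    unfolding integral_manifold_def
  proof (intro conjI Hausdorff_orbit_topology second_countable_orbit_topology ballI)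
    fix p assume "p \<in> topspace (orbit_topology w a)"
    then have p: "p \<in> orbit w a" by simp
    obtain \<psi> N V g where box: "plaque_box w p \<psi> N V g" using plaque_box_exists by blast
    have sub: "\<psi> ` N \<subseteq> orbit w a" using plaque_box_N(4) [OF box] orbit_eq [OF p] by simp
    have subt: "subtopology (orbit_topology w a) (\<psi> ` N) = subtopology (leaf_topology w) (\<psi> ` N)"
      using sub by (simp add: orbit_topology_def subtopology_subtopology Int_absorb1)
    have opn: "openin (orbit_topology w a) (\<psi> ` N)"
      unfolding openin_orbit_topology
      using openin_plaque [OF box plaque_box_N(1) [OF box] subset_refl] sub by blast
    have pin: "p \<in> \<psi> ` N" using plaque_box_N(2,3) [OF box] by (metis image_eqI)
    show "\<exists>(V :: 'n cmatrix set) U \<phi>. cmat.subspace V \<and> openin (top_of_set V) U \<and> p \<in> \<phi> ` U \<and>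
        openin (orbit_topology w a) (\<phi> ` U) \<and>
        homeomorphic_map (top_of_set U) (subtopology (orbit_topology w a) (\<phi> ` U)) \<phi> \<and>
        (\<forall>u\<in>U. \<exists>\<phi>'. (\<phi> has_derivative \<phi>') (at u within V) \<and> Vector_Spaces.linear cscale cscale \<phi>' \<and>
           inj_on \<phi>' V \<and> \<phi>' ` V = hamiltonian_distribution w (\<phi> u))"
    proof (rule exI [of _ "hamiltonian_distribution w p"], rule exI [of _ N], rule exI [of _ \<psi>], intro conjI ballI)
      show "cmat.subspace (hamiltonian_distribution w p)" by simp
      show "openin (top_of_set (hamiltonian_distribution w p)) N" by (rule plaque_box_N(1) [OF box])
      show "p \<in> \<psi> ` N" by (rule pin)
      show "openin (orbit_topology w a) (\<psi> ` N)" by (rule opn)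
      show "homeomorphic_map (top_of_set N) (subtopology (orbit_topology w a) (\<psi> ` N)) \<psi>"
        unfolding subt by (rule plaque_homeomorphic_map [OF box])
      show "\<exists>\<psi>'. (\<psi> has_derivative \<psi>') (at u within hamiltonian_distribution w p) \<and>
          Vector_Spaces.linear cscale cscale \<psi>' \<and> inj_on \<psi>' (hamiltonian_distribution w p) \<and>
          \<psi>' ` hamiltonian_distribution w p = hamiltonian_distribution w (\<psi> u)" if "u \<in> N" for u
        by (rule plaque_box_deriv [OF box that])
    qed
  qed
qed

text \<open>
  The charts of an integral manifold are tangent to the leaves, hence continuous for the leaf topology, in
  which orbits are open. So the orbits cut the manifold into open pieces, and it is connected.
\<close>

lemma connected_integral_manifold_subset_orbit:
  assumes L: "connected_integral_manifold (hamiltonian_distribution w) L" and a: "a \<in> L"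
  shows "L \<subseteq> orbit w a"
proof -
  obtain T where T: "topspace T = L" "connected_space T" "integral_manifold (hamiltonian_distribution w) T"
    using L unfolding connected_integral_manifold_def by blast
  \<comment> \<open>Near each of its points, the manifold stays in the orbit of this point.\<close>
  have loc: "\<exists>W. openin T W \<and> x \<in> W \<and> W \<subseteq> orbit w x" if x: "x \<in> L" for x
  proof -
    obtain V :: "'a cmatrix set" and U \<phi> where V: "cmat.subspace V" and U: "openin (top_of_set V) U"
        and x: "x \<in> \<phi> ` U" "openin T (\<phi> ` U)"
        and hom: "homeomorphic_map (top_of_set U) (subtopology T (\<phi> ` U)) \<phi>"
        and der: "\<forall>u\<in>U. \<exists>\<phi>'. (\<phi> has_derivative \<phi>') (at u within V) \<and>
           Vector_Spaces.linear cscale cscale \<phi>' \<and>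
           inj_on \<phi>' V \<and> \<phi>' ` V = hamiltonian_distribution w (\<phi> u)"
      using T(3) x unfolding integral_manifold_def T(1) by blast
    have dim: "cmat.dim (hamiltonian_distribution w (\<phi> u)) = cmat.dim V" if "u \<in> U" for u
    proof -
      obtain \<phi>' where \<phi>': "Vector_Spaces.linear cscale cscale \<phi>'" "inj_on \<phi>' V" "\<phi>' ` V = hamiltonian_distribution w (\<phi> u)"
        using der \<open>u \<in> U\<close> by blast
      have span: "cmat.span V = V" using V by (simp add: cmat.span_eq_iff)
      have "cmat.dim (\<phi>' ` V) = cmat.dim V"
        by (rule cmatpair.dim_image_eq [OF \<phi>'(1)]) (unfold span, fact \<phi>'(2))
      then show ?thesis unfolding \<phi>'(3) .
    qed
    have lw: "leafwise w V U \<phi>"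
      unfolding leafwise_def using der dim by (metis subset_refl)
    have "openin (top_of_set U) {u \<in> topspace (top_of_set U). \<phi> u \<in> orbit w x}"
      by (rule openin_continuous_map_preimage [OF leafwise_continuous [OF csubspace_imp_subspace [OF V] U lw] openin_orbit])
    then have "openin (subtopology T (\<phi> ` U)) (\<phi> ` {u \<in> U. \<phi> u \<in> orbit w x})"
      using homeomorphic_imp_open_map [OF hom] unfolding open_map_def by simp
    then have "openin T (\<phi> ` {u \<in> U. \<phi> u \<in> orbit w x})"
      using openin_open_subtopology [OF x(2)] by simp
    moreover have "x \<in> \<phi> ` {u \<in> U. \<phi> u \<in> orbit w x}"
    proof -
      obtain u where "u \<in> U" "x = \<phi> u" using x(1) by blast
      then show ?thesis by (intro image_eqI [of _ _ u]) (simp_all add: orbit.base)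
    qed
    ultimately show ?thesis by blast
  qed
  have inside: "openin T (L \<inter> orbit w a)"
  proof (subst openin_subopen, intro ballI)
    fix x assume x: "x \<in> L \<inter> orbit w a"
    then obtain W where "openin T W" "x \<in> W" "W \<subseteq> orbit w x" using loc by blast
    then show "\<exists>W. openin T W \<and> x \<in> W \<and> W \<subseteq> L \<inter> orbit w a"
      using x orbit_eq [of x w a] openin_subset T(1) by blast
  qed
  have outside: "openin T (L - orbit w a)"
  proof (subst openin_subopen, intro ballI)
    fix x assume x: "x \<in> L - orbit w a"
    then obtain W where W: "openin T W" "x \<in> W" "W \<subseteq> orbit w x" using loc by blast
    moreover have "y \<notin> orbit w a" if "y \<in> W" for y
      using x W(3) that orbit_eq [of y w x] orbit_eq [of y w a] orbit.base [of x w] by blast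
    ultimately show "\<exists>W. openin T W \<and> x \<in> W \<and> W \<subseteq> L - orbit w a"
      using openin_subset T(1) by blast
  qed
  have "closedin T (L \<inter> orbit w a)"
    unfolding closedin_def T(1) using outside by (simp add: Diff_Int)
  with inside T(2) have "L \<inter> orbit w a = {} \<or> L \<inter> orbit w a = L"
    unfolding connected_space_clopen_in T(1) by blast
  then show ?thesis using a orbit.base by blast
qed

text \<open>
  Every orbit is a connected integral manifold and contains all those that meet it. Hence the orbits are
  the maximal ones; in particular there is a leaf through every point.
\<close>

lemma symplectic_leaf_iff_orbit: "symplectic_leaf w L \<longleftrightarrow> (\<exists>a. L = orbit w a)"
proof
  assume L: "symplectic_leaf w L"
  then obtain a where a: "a \<in> L"
    unfolding symplectic_leaf_def connected_integral_manifold_def by blast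
  have "L \<subseteq> orbit w a"
    using L a connected_integral_manifold_subset_orbit unfolding symplectic_leaf_def by blast
  then show "\<exists>a. L = orbit w a"
    using L orbit_connected_integral_manifold unfolding symplectic_leaf_def by blast
next
  assume "\<exists>a. L = orbit w a"
  then obtain a where a: "L = orbit w a" by blast
  show "symplectic_leaf w L"
    unfolding symplectic_leaf_def a
  proof (intro conjI allI impI orbit_connected_integral_manifold)
    fix L' assume L': "connected_integral_manifold (hamiltonian_distribution w) L'" "orbit w a \<subseteq> L'"
    have "L' \<subseteq> orbit w a"
      using connected_integral_manifold_subset_orbit [OF L'(1)] L'(2) orbit.base by blast
    with L'(2) show "L' = orbit w a" by blast
  qed
qed

theorem proposition5p7:
  fixes w w' :: "'n::{finite,linorder} param"
  assumes "w \<in> params" and "w' \<in> params"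
  shows "symplectic_loaves w = symplectic_loaves w'"
proof -
  have "symplectic_loaves v = range (\<lambda>a. \<Union>g\<in>S_mult. g ` orbit v a)" for v :: "'n param"
    by (auto simp: symplectic_loaves_def symplectic_leaf_iff_orbit)
  moreover have "(\<Union>g\<in>S_mult. g ` orbit w a) = (\<Union>g\<in>S_mult. g ` orbit w' a)" for a
    by (intro equalityI torus_orbit_invariant)
  ultimately show ?thesis by simp
qed

end
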